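(* The knots $8_{20}$ (which is type I) and $10_{140}$ (which is type II) cannot be distinguished by linear Alexander quandles: for every positive integer $n$ and every integer $m$ with $\gcd(m,n)=1$, the quandle $Q=\mathbb{Z}_n[t,t^{-1}]/(t-m)$ satisfies $C_Q(8_{20})=C_Q(10_{140})$.
   Context: **Knot names.** Knots are named as in Rolfsen's table of prime knots up to ten crossings. **Linear finite Alexander quandle.** For coprime integers $n\ge 1$ and $m$, the quandle $Q=\mathbb{Z}_n[t,t^{-1}]/(t-m)$ is identified with $\mathbb{Z}_n$, with operations $a\ast b=ma+(1-m)b$ and $a\ast' b=m^{-1}a+(1-m^{-1})b$ modulo $n$. **Colourings.** Let $D$ be an oriented diagram of a knot $K$ with $N\ge1$ crossings, hence $N$ arcs. A colouring of $D$ by $Q$ assigns $X_k\in Q$ to each arc $k$ so that at each crossing with incoming under-arc $i$, outgoing under-arc $i'$ and over-arc $j$: $X_{i'}=X_i\ast X_j$ if the crossing is positive (right-handed), $X_{i'}=X_i\ast' X_j$ if it is negative (left-handed). $C_Q(K)$ is the number of colourings; it does not depend on the diagram of $K$. **Colouring matrix.** The $N\times N$ matrix over $\mathbb{Z}[m,m^{-1}]$ ($m$ regarded as an indeterminate), one row per crossing, encoding $mX_i+(1-m)X_j-X_{i'}=0$ (positive crossing) or $m^{-1}X_i+(1-m^{-1})X_j-X_{i'}=0$ (negative crossing); if some of $i,i',j$ coincide the corresponding entries are added. **Equivalent matrices.** $B$ is equivalent to a colouring matrix $A$ if it is obtained from $A$ by finitely many operations of the following kinds: (a) multiplying a row by $m$,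 $m^{-1}$ or $-1$; (b) replacing a row by its sum with another row; (c) swapping two rows; (d) swapping two columns. **Type I and type II.** An $N\times N$ matrix is of type I if it is upper triangular with diagonal $(1,\dots,1,\alpha(m),0)$, its row $N-1$ is $(0,\dots,0,\alpha(m),-\alpha(m))$, and its last row is zero. It is of type II if it is upper triangular with diagonal $(1,\dots,1,\alpha_1(m),\alpha_2(m),0)$, its row $N-2$ is $(0,\dots,0,\alpha_1(m),\beta_1(m),-(\alpha_1(m)+\beta_1(m)))$, its row $N-1$ is $(0,\dots,0,\alpha_2(m),-\alpha_2(m))$, and its last row is zero. Other above-diagonal entries are arbitrary. A knot is type I (resp. type II) if it has a colouring matrix equivalent to a matrix of type I (resp. type II). *)

theory Defs
  imports
    "Jordan_Normal_Form.Gauss_Jordan_Elimination"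
    "Jordan_Normal_Form.Column_Operations"
    "HOL-Library.Poly_Mapping"
    "HOL-Library.FuncSet"
    "HOL-Combinatorics.Orbits"
    "HOL-Number_Theory.Modular_Inverse"
begin

section \<open>Oriented knot diagrams\<close>

text \<open>
  An oriented knot diagram is given by its signed Gauss code: travelling once around the knot, one
  records for every passage through a crossing the label of the crossing, whether one passes over or
  under, and whether the crossing is positive (right-handed). A code is read cyclically.
\<close>

datatype 'c passage =
    is_Over: Over (crossing: 'c) (positive: bool)
  | is_Under: Under (crossing: 'c) (positive: bool)

type_synonym gauss_code = "nat passage list"

definition wf_code :: "gauss_code \<Rightarrow> bool" where
  "wf_code D \<longleftrightarrow> D \<noteq> [] \<and>
     distinct (map crossing (filter is_Over D)) \<and>
     distinct (map crossing (filter is_Under D)) \<and>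
     (\<forall>c s. Over c s \<in> set D \<longleftrightarrow> Under c s \<in> set D)"

definition num_crossings :: "gauss_code \<Rightarrow> nat" where
  "num_crossings D = length (filter is_Under D)"

text \<open>The position of the second passage through the crossing met at position \<open>p\<close>.\<close>

definition other :: "gauss_code \<Rightarrow> nat \<Rightarrow> nat" where
  "other D p = the (find (\<lambda>q. q \<noteq> p \<and> crossing (D ! q) = crossing (D ! p)) [0..<length D])"

text \<open>
  A signed Gauss code comes from a diagram in the sphere iff the closed surface it determines has
  genus 0. Edge \<open>k\<close> of the underlying 4-valent graph runs from position \<open>k\<close> to position \<open>k + 1\<close>; the
  pair \<open>(k, f)\<close> stands for edge \<open>k\<close> traversed along (\<open>f = True\<close>) or against the orientation. Turning
  left at every vertex walks around the face to the left of the edge. The crossing strand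
  is directed from right to left across a strand traversed along its orientation iff that strand is
  the over-strand of a positive crossing or the under-strand of a negative one. The graph is
  connected with \<open>N\<close> vertices and \<open>2N\<close> edges, so by Euler's formula genus 0 means \<open>N + 2\<close> faces.
\<close>

definition turn_left :: "gauss_code \<Rightarrow> nat \<times> bool \<Rightarrow> nat \<times> bool" where
  "turn_left D = (\<lambda>(k, f).
     let p = (if f then Suc k mod length D else k);
         q = other D p
     in if (is_Over (D ! p) = positive (D ! p)) = f
        then (q, True)
        else ((q + length D - 1) mod length D, False))"

definition faces :: "gauss_code \<Rightarrow> (nat \<times> bool) set set" where
  "faces D = orbit (turn_left D) ` ({..<length D} \<times> UNIV)"

definition knot_diagram :: "gauss_code \<Rightarrow> bool" where
  "knot_diagram D \<longleftrightarrow> wf_code D \<and> card (faces D) = num_crossings D + 2"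


section \<open>Reidemeister moves and knots\<close>

text \<open>
  The passages of three strands (top, middle, bottom) through the three crossings of a Reidemeister
  triangle: \<open>a\<close> is top over middle, \<open>b\<close> top over bottom, \<open>c\<close> middle over bottom. The flags \<open>t\<close>,
  \<open>u\<close>, \<open>d\<close> tell whether the top, middle and bottom strand meet their two crossings in the listed
  order. Read flags as signs and let \<open>T\<close>, \<open>M\<close>, \<open>B\<close> be the directions of the strands. Since the triangle
  closes, these vectors can be scaled by positive factors so that \<open>t T + d B = u M\<close>. As \<open>sa\<close>, \<open>sb\<close>,
  \<open>sc\<close> are the signs of the determinants of \<open>(T, M)\<close>, \<open>(T, B)\<close>, \<open>(M, B)\<close>, this yields
  \<open>d sb = u sa\<close> and \<open>t sb = u sc\<close>; conversely, these two conditions suffice for such a triangle to exist.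
\<close>

definition ordered :: "bool \<Rightarrow> 'a list \<Rightarrow> 'a list" where
  "ordered x ps = (if x then ps else rev ps)"

definition triangle ::
  "'c passage list \<Rightarrow> 'c passage list \<Rightarrow> 'c passage list \<Rightarrow> bool" where
  "triangle P Q R \<longleftrightarrow> (\<exists>a b c sa sb sc t u d.
     P = ordered t [Over a sa, Over b sb] \<and>
     Q = ordered u [Under a sa, Over c sc] \<and>
     R = ordered d [Under b sb, Under c sc] \<and>
     (d = u \<longleftrightarrow> sa = sb) \<and> (t = u \<longleftrightarrow> sb = sc))"

text \<open>
  The first two rules only change the description of a diagram. Moves I and II are given in the
  direction that creates crossings; a third move slides a triangle and thereby reverses the
  order of the two passages on each of its three strands.
\<close>

inductive reidemeister_move :: "gauss_code \<Rightarrow> gauss_code \<Rightarrow> bool" where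
  rotate: "reidemeister_move (u @ v) (v @ u)"
| relabel: "inj_on f (crossing ` set D) \<Longrightarrow> reidemeister_move D (map (map_passage f) D)"
| R1_over: "c \<notin> crossing ` set D \<Longrightarrow> reidemeister_move D ([Over c s, Under c s] @ D)"
| R1_under: "c \<notin> crossing ` set D \<Longrightarrow> reidemeister_move D ([Under c s, Over c s] @ D)"
| R2_parallel: "a \<noteq> b \<Longrightarrow> {a, b} \<inter> crossing ` set (u @ v) = {} \<Longrightarrow>
    reidemeister_move (u @ v)
      ([Over a s, Over b (\<not> s)] @ u @ [Under a s, Under b (\<not> s)] @ v)"
| R2_antiparallel: "a \<noteq> b \<Longrightarrow> {a, b} \<inter> crossing ` set (u @ v) = {} \<Longrightarrow>
    reidemeister_move (u @ v)
      ([Over a s, Over b (\<not> s)] @ u @ [Under b (\<not> s), Under a s] @ v)"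
| R3_TMB: "triangle P Q R \<Longrightarrow>
    reidemeister_move (P @ u @ Q @ v @ R @ w) (rev P @ u @ rev Q @ v @ rev R @ w)"
| R3_TBM: "triangle P Q R \<Longrightarrow>
    reidemeister_move (P @ u @ R @ v @ Q @ w) (rev P @ u @ rev R @ v @ rev Q @ w)"

definition reidemeister_equivalent :: "gauss_code \<Rightarrow> gauss_code \<Rightarrow> bool" where
  "reidemeister_equivalent =
     equivclp (\<lambda>D E. knot_diagram D \<and> knot_diagram E \<and> reidemeister_move D E)"

text \<open>A knot is represented by the set of all its oriented diagrams.\<close>

type_synonym knot = "gauss_code set"

definition knot_of :: "gauss_code \<Rightarrow> knot" where
  "knot_of D = {E. knot_diagram E \<and> reidemeister_equivalent D E}"

text \<open>Reflection of the diagram in a line of the plane, which preserves over and under.\<close>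

fun mirror_passage :: "'c passage \<Rightarrow> 'c passage" where
  "mirror_passage (Over c s) = Over c (\<not> s)"
| "mirror_passage (Under c s) = Under c (\<not> s)"

definition mirror :: "gauss_code \<Rightarrow> gauss_code" where
  "mirror D = map mirror_passage D"

text \<open>
  The standard diagrams of the pretzel knots \<open>P(3,-3,2) = 8_20\<close> and \<open>P(4,3,-3) = 10_140\<close>.
  Rolfsen's table lists knots up to reflection and reversal. Both knots are invertible, so the choice
  of orientation is immaterial; their mirror images are obtained with \<open>mirror\<close>.
\<close>

definition diagram_8_20 :: gauss_code where
  "diagram_8_20 =
     [Under 1 True, Over 2 True, Under 3 True, Under 4 False,
      Over 5 False, Under 6 False, Under 7 False, Over 8 False,
      Over 4 False, Under 5 False, Over 6 False, Over 1 True,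
      Under 2 True, Over 3 True, Under 8 False, Over 7 False]"

definition diagram_10_140 :: gauss_code where
  "diagram_10_140 =
     [Under 1 False, Over 2 False, Under 3 False, Over 4 False,
      Over 5 False, Under 6 False, Over 7 False, Over 8 True,
      Under 9 True, Over 10 True, Under 4 False, Over 3 False,
      Under 2 False, Over 1 False, Under 8 True, Over 9 True,
      Under 10 True, Under 5 False, Over 6 False, Under 7 False]"


section \<open>Colourings\<close>

text \<open>
  The arcs of a diagram with \<open>N\<close> crossings are numbered \<open>0, ..., N - 1\<close> in the order in which they
  are met; every \<open>Under\<close> passage ends one arc and starts the next. \<open>arc_at D p\<close> is the arc by which
  position \<open>p\<close> is entered, so an under-passage at \<open>p\<close> leads from \<open>arc_at D p\<close> to \<open>arc_at D (Suc p)\<close>, below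
  \<open>arc_at D (other D p)\<close>.
\<close>

definition arc_at :: "gauss_code \<Rightarrow> nat \<Rightarrow> nat" where
  "arc_at D p = length (filter is_Under (take p D)) mod num_crossings D"

definition colourings ::
  "'q set \<Rightarrow> ('q \<Rightarrow> 'q \<Rightarrow> 'q) \<Rightarrow> ('q \<Rightarrow> 'q \<Rightarrow> 'q) \<Rightarrow> gauss_code \<Rightarrow> (nat \<Rightarrow> 'q) set" where
  "colourings Q op op' D =
     {X \<in> {..<num_crossings D} \<rightarrow>\<^sub>E Q. \<forall>p < length D. is_Under (D ! p) \<longrightarrow>
        X (arc_at D (Suc p)) =
          (if positive (D ! p) then op else op') (X (arc_at D p)) (X (arc_at D (other D p)))}"

definition alexander_op :: "nat \<Rightarrow> int \<Rightarrow> int \<Rightarrow> int \<Rightarrow> int" where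
  "alexander_op n m a b = (m * a + (1 - m) * b) mod int n"

definition num_alexander_colourings :: "nat \<Rightarrow> int \<Rightarrow> gauss_code \<Rightarrow> nat" where
  "num_alexander_colourings n m D =
     card (colourings {0..<int n}
       (alexander_op n m) (alexander_op n (modular_inverse (int n) m)) D)"


section \<open>Colouring matrices\<close>

text \<open>
  The ring \<open>\<int>[m, m\<inverse>]\<close>, as the group ring of the additive group \<open>\<int>\<close> over \<open>\<int>\<close>:
  exponents are mapped to coefficients.
\<close>

type_synonym laurent = "int \<Rightarrow>\<^sub>0 int"

definition var :: laurent where "var = Poly_Mapping.single 1 1"

definition var_inv :: laurent where "var_inv = Poly_Mapping.single (-1) 1"

definition under_positions :: "gauss_code \<Rightarrow> nat list" where
  "under_positions D = filter (\<lambda>p. is_Under (D ! p)) [0..<length D]"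

text \<open>
  Rows are ordered by the position of the under-passage, columns as the arcs. Any other numbering of
  crossings and arcs only swaps rows and columns.
\<close>

definition colouring_matrix :: "gauss_code \<Rightarrow> laurent mat" where
  "colouring_matrix D = mat (num_crossings D) (num_crossings D) (\<lambda>(r, k).
     let p = under_positions D ! r;
         t = (if positive (D ! p) then var else var_inv)
     in (if k = arc_at D p then t else 0)
      + (if k = arc_at D (other D p) then 1 - t else 0)
      + (if k = arc_at D (Suc p) then - 1 else 0))"

inductive matrix_operation :: "laurent mat \<Rightarrow> laurent mat \<Rightarrow> bool" where
  scale_row: "i < dim_row A \<Longrightarrow> c \<in> {var, var_inv, - 1} \<Longrightarrow> matrix_operation A (multrow i c A)"
| add_row: "i < dim_row A \<Longrightarrow> j < dim_row A \<Longrightarrow> i \<noteq> j \<Longrightarrow> matrix_operation A (addrow 1 i j A)"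
| swap_rows: "i < dim_row A \<Longrightarrow> j < dim_row A \<Longrightarrow> matrix_operation A (swaprows i j A)"
| swap_cols: "i < dim_col A \<Longrightarrow> j < dim_col A \<Longrightarrow> matrix_operation A (swapcols i j A)"

definition equivalent_to :: "laurent mat \<Rightarrow> laurent mat \<Rightarrow> bool" where
  "equivalent_to B A \<longleftrightarrow> matrix_operation\<^sup>*\<^sup>* A B"

definition type_I_matrix :: "laurent mat \<Rightarrow> bool" where
  "type_I_matrix A \<longleftrightarrow> (\<exists>N \<ge> 2. \<exists>\<alpha>.
     A \<in> carrier_mat N N \<and> upper_triangular A \<and>
     (\<forall>i < N - 2. A $$ (i, i) = 1) \<and>
     A $$ (N - 2, N - 2) = \<alpha> \<and> A $$ (N - 2, N - 1) = - \<alpha> \<and>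
     A $$ (N - 1, N - 1) = 0)"

definition type_II_matrix :: "laurent mat \<Rightarrow> bool" where
  "type_II_matrix A \<longleftrightarrow> (\<exists>N \<ge> 3. \<exists>\<alpha>\<^sub>1 \<beta>\<^sub>1 \<alpha>\<^sub>2.
     A \<in> carrier_mat N N \<and> upper_triangular A \<and>
     (\<forall>i < N - 3. A $$ (i, i) = 1) \<and>
     A $$ (N - 3, N - 3) = \<alpha>\<^sub>1 \<and> A $$ (N - 3, N - 2) = \<beta>\<^sub>1 \<and>
     A $$ (N - 3, N - 1) = - (\<alpha>\<^sub>1 + \<beta>\<^sub>1) \<and>
     A $$ (N - 2, N - 2) = \<alpha>\<^sub>2 \<and> A $$ (N - 2, N - 1) = - \<alpha>\<^sub>2 \<and>
     A $$ (N - 1, N - 1) = 0)"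

definition type_I :: "knot \<Rightarrow> bool" where
  "type_I K \<longleftrightarrow> (\<exists>D \<in> K. \<exists>A. equivalent_to A (colouring_matrix D) \<and> type_I_matrix A)"

definition type_II :: "knot \<Rightarrow> bool" where
  "type_II K \<longleftrightarrow> (\<exists>D \<in> K. \<exists>A. equivalent_to A (colouring_matrix D) \<and> type_II_matrix A)"

end

theory Submission
  imports Defs
begin

text \<open>
  Colourings by a quandle, read as transport of a colour once around the Gauss code, are matched
  bijectively by every Reidemeister move, so it suffices to treat the four given diagrams. For these the colouring
  matrix reduces to triangular form: with \<open>d = 1 - s + s * s\<close> and \<open>s\<close> the variable or its inverse, the
  first knot has \<open>\<alpha> = - d * d\<close>, the second \<open>\<alpha>\<^sub>1 = s * d\<close>, \<open>\<beta>\<^sub>1 = s * (d - 2)\<close> and \<open>\<alpha>\<^sub>2 = t * d\<close> with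
  \<open>t * s = 1\<close>. Row operations and column swaps preserve the number of solutions modulo \<open>n\<close>. At an
  integer the value of \<open>d\<close> is odd, so \<open>d\<close> and \<open>d - 2\<close> generate the unit ideal and the second system, too,
  reduces to the single equation \<open>d * d * w = 0\<close>. Hence both knots have \<open>n\<close> times as many colourings
  as this equation has solutions.
\<close>

section \<open>Quandle colourings and Reidemeister moves\<close>

text \<open>Both knots have the Alexander polynomial \<open>d * d\<close>, yet their reduced systems
  are not equivalent over the Laurent polynomials. Apart from the free part that accounts for
  constant colourings, the first presents a cyclic module; in the second,
  \<open>\<alpha>\<^sub>1\<close>, \<open>\<beta>\<^sub>1\<close> and
  \<open>\<alpha>\<^sub>2\<close> all lie in the proper ideal generated by 2 and \<open>d\<close>,
  so two generators are required. Colourings by the field with four elements, in which 2 and a value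
  of \<open>d\<close> vanish, tell the knots apart. Hence no manipulation of matrices over the
  Laurent polynomials can identify the two counts: an integer has to be substituted first, and the
  evenness of \<open>x * x - x\<close> is what makes \<open>d\<close> odd and the ideal trivial. The
  substitution sends the inverse of the variable to an integer that is an inverse only modulo
  \<open>n\<close>, so it respects products only up to congruence. Mirror images exchange the
  variable and its inverse; as \<open>d\<close> is palindromic, this changes it only by a
  unit.\<close>

primrec transport ::
  "(bool \<Rightarrow> 'q \<Rightarrow> 'q \<Rightarrow> 'q) \<Rightarrow> ('c \<Rightarrow> 'q) \<Rightarrow> 'c passage list \<Rightarrow> 'q \<Rightarrow> 'q" where
  "transport act g [] x = x"
| "transport act g (p # D) x =
     transport act g D (if is_Under p then act (positive p) x (g (crossing p)) else x)"

text \<open>The table \<open>g\<close> is a guess of all over-strand colours. An under-passage acts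
  by the guess; an over-passage checks the guess against the colour that arrives.\<close>

primrec compatible ::
  "(bool \<Rightarrow> 'q \<Rightarrow> 'q \<Rightarrow> 'q) \<Rightarrow> ('c \<Rightarrow> 'q) \<Rightarrow> 'c passage list \<Rightarrow> 'q \<Rightarrow> bool" where
  "compatible act g [] x \<longleftrightarrow> True"
| "compatible act g (p # D) x \<longleftrightarrow> (is_Over p \<longrightarrow> x = g (crossing p)) \<and>
     compatible act g D (if is_Under p then act (positive p) x (g (crossing p)) else x)"

lemma transport_append [simp]:
  "transport act g (D @ E) x = transport act g E (transport act g D x)"
  by (induction D arbitrary: x) auto

lemma compatible_append [simp]:
  "compatible act g (D @ E) x \<longleftrightarrow>
     compatible act g D x \<and> compatible act g E (transport act g D x)"
  by (induction D arbitrary: x) auto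

lemma transport_cong:
  "(\<And>c. c \<in> crossing ` set D \<Longrightarrow> g c = h c) \<Longrightarrow> transport act g D x = transport act h D x"
  by (induction D arbitrary: x) auto

lemma compatible_cong:
  "(\<And>c. c \<in> crossing ` set D \<Longrightarrow> g c = h c) \<Longrightarrow> compatible act g D x = compatible act h D x"
  by (induction D arbitrary: x) auto

lemma transport_relabel:
  "transport act g (map (map_passage f) D) x = transport act (g \<circ> f) D x"
proof (induction D arbitrary: x)
  case (Cons p D)
  then show ?case by (cases p) auto
qed simp

lemma compatible_relabel:
  "compatible act g (map (map_passage f) D) x = compatible act (g \<circ> f) D x"
proof (induction D arbitrary: x)
  case (Cons p D)
  then show ?case by (cases p) auto
qed simp

lemma crossing_map_passage: "crossing ` map_passage f ` A = f ` crossing ` A"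
proof -
  have "crossing (map_passage f p) = f (crossing p)" for p
    by (cases p) auto
  then show ?thesis by (auto simp: image_image)
qed

lemma crossing_split:
  "crossing ` set D = crossing ` set (filter is_Over D) \<union> crossing ` set (filter is_Under D)"
proof -
  have "is_Over p \<or> is_Under p" for p :: "'a passage"
    by (cases p) auto
  then show ?thesis by auto
qed

lemma ordered_simps [simp]:
  "set (ordered x ps) = set ps" "distinct (ordered x ps) = distinct ps"
  "filter P (ordered x ps) = ordered x (filter P ps)" "map f (ordered x ps) = ordered x (map f ps)"
  "rev (ordered x ps) = ordered (\<not> x) ps"
  by (auto simp: ordered_def rev_filter rev_map)

text \<open>
  A colouring is encoded by the colours \<open>g c\<close> of the over-strands at the crossings and the colour \<open>x\<close>
  at the base point. All other colours follow by transport along the code, so this form splits over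
  concatenation, as the moves require.
\<close>

definition closed_colourings ::
  "'q set \<Rightarrow> (bool \<Rightarrow> 'q \<Rightarrow> 'q \<Rightarrow> 'q) \<Rightarrow> 'c passage list \<Rightarrow> (('c \<Rightarrow> 'q) \<times> 'q) set" where
  "closed_colourings Q act D =
     {(g, x). g \<in> crossing ` set D \<rightarrow>\<^sub>E Q \<and> x \<in> Q \<and>
        compatible act g D x \<and> transport act g D x = x}"

text \<open>\<open>act True\<close> and \<open>act False\<close> are the two mutually inverse
  operations. Distributivity is demanded for every pair of signs because the crossings of a
  Reidemeister triangle occur with either sign.\<close>

locale quandle =
  fixes Q :: "'q set" and act :: "bool \<Rightarrow> 'q \<Rightarrow> 'q \<Rightarrow> 'q"
  assumes act_closed: "x \<in> Q \<Longrightarrow> y \<in> Q \<Longrightarrow> act s x y \<in> Q"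
    and act_idem: "x \<in> Q \<Longrightarrow> act s x x = x"
    and act_inverse: "x \<in> Q \<Longrightarrow> y \<in> Q \<Longrightarrow> act (\<not> s) (act s x y) y = x"
    and act_distrib: "x \<in> Q \<Longrightarrow> y \<in> Q \<Longrightarrow> z \<in> Q \<Longrightarrow>
      act s (act r x y) z = act r (act s x z) (act s y z)"
begin

lemma act_inverse': "x \<in> Q \<Longrightarrow> y \<in> Q \<Longrightarrow> act s (act (\<not> s) x y) y = x"
  using act_inverse[of x y "\<not> s"] by simp

lemma transport_closed:
  assumes "x \<in> Q" "\<And>c. c \<in> crossing ` set D \<Longrightarrow> g c \<in> Q"
  shows "transport act g D x \<in> Q"
  using assms by (induction D arbitrary: x) (auto simp: act_closed)

text \<open>Moving the base point past \<open>u\<close> replaces its colour by the transported one.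
  The way back is transport along \<open>v\<close>; since the colour closes up, the two are mutually
  inverse.\<close>

lemma closed_rotate:
  "card (closed_colourings Q act (u @ v)) = card (closed_colourings Q act (v @ u))"
proof (rule bij_betw_same_card, rule bij_betw_byWitness)
  let ?f = "\<lambda>w (g, x). (g, transport act g w x)"
  show "\<forall>a \<in> closed_colourings Q act (u @ v). ?f v (?f u a) = a"
    "\<forall>a \<in> closed_colourings Q act (v @ u). ?f u (?f v a) = a"
    by (auto simp: closed_colourings_def)
  have "?f u ` closed_colourings Q act (u @ v) \<subseteq> closed_colourings Q act (v @ u)" for u v
    by (auto simp: closed_colourings_def Un_commute intro!: transport_closed)
  then show "?f u ` closed_colourings Q act (u @ v) \<subseteq> closed_colourings Q act (v @ u)"
    "?f v ` closed_colourings Q act (v @ u) \<subseteq> closed_colourings Q act (u @ v)"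
    by blast+
qed

lemma closed_relabel:
  assumes "inj_on f (crossing ` set D)"
  shows "card (closed_colourings Q act D) = card (closed_colourings Q act (map (map_passage f) D))"
proof (rule bij_betw_same_card, rule bij_betw_byWitness)
  let ?C = "crossing ` set D"
  let ?F = "\<lambda>(g, x). (\<lambda>c\<in>f ` ?C. g (inv_into ?C f c), x)"
  let ?G = "\<lambda>(h, x). (\<lambda>c\<in>?C. h (f c), x)"
  have inv: "inv_into ?C f (f c) = c" if "c \<in> ?C" for c
    using assms that by (rule inv_into_f_f)
  show "\<forall>a \<in> closed_colourings Q act D. ?G (?F a) = a"
    by (auto simp: closed_colourings_def inv PiE_iff intro!: extensionalityI[of _ ?C])
  show "\<forall>a \<in> closed_colourings Q act (map (map_passage f) D). ?F (?G a) = a"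
    by (auto simp: closed_colourings_def crossing_map_passage inv PiE_iff
        intro!: extensionalityI[of _ "f ` ?C"])
  show "?F ` closed_colourings Q act D \<subseteq> closed_colourings Q act (map (map_passage f) D)"
  proof clarify
    fix g x assume "(g, x) \<in> closed_colourings Q act D"
    moreover have "(\<And>c. c \<in> ?C \<Longrightarrow> ((\<lambda>c\<in>f ` ?C. g (inv_into ?C f c)) \<circ> f) c = g c)"
      by (auto simp: inv)
    ultimately show "(\<lambda>c\<in>f ` ?C. g (inv_into ?C f c), x)
        \<in> closed_colourings Q act (map (map_passage f) D)"
      unfolding closed_colourings_def set_map crossing_map_passage transport_relabel compatible_relabel
      using transport_cong[of D "(\<lambda>c\<in>f ` ?C. g (inv_into ?C f c)) \<circ> f" g]
        compatible_cong[of D "(\<lambda>c\<in>f ` ?C. g (inv_into ?C f c)) \<circ> f" g]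
      by (auto simp: inv)
  qed
  show "?G ` closed_colourings Q act (map (map_passage f) D) \<subseteq> closed_colourings Q act D"
  proof clarify
    fix h x assume "(h, x) \<in> closed_colourings Q act (map (map_passage f) D)"
    then show "(\<lambda>c\<in>?C. h (f c), x) \<in> closed_colourings Q act D"
      unfolding closed_colourings_def set_map crossing_map_passage transport_relabel compatible_relabel
      using transport_cong[of D "\<lambda>c\<in>?C. h (f c)" "h \<circ> f"]
        compatible_cong[of D "\<lambda>c\<in>?C. h (f c)" "h \<circ> f"]
      by auto
  qed
qed

text \<open>Moves I and II create crossings whose over-strand colours are forced.\<close>

lemma closed_new_crossings:
  assumes "A \<inter> crossing ` set D = {}" and "crossing ` set E = A \<union> crossing ` set D"
    and forced: "\<And>h x a. h \<in> crossing ` set E \<rightarrow>\<^sub>E Q \<Longrightarrow> x \<in> Q \<Longrightarrow> compatible act h E x \<Longrightarrow>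
      a \<in> A \<Longrightarrow> h a = x"
    and same: "\<And>h x. h \<in> crossing ` set E \<rightarrow>\<^sub>E Q \<Longrightarrow> x \<in> Q \<Longrightarrow> \<forall>a\<in>A. h a = x \<Longrightarrow>
      compatible act h E x = compatible act h D x \<and> transport act h E x = transport act h D x"
  shows "card (closed_colourings Q act D) = card (closed_colourings Q act E)"
proof (rule bij_betw_same_card, rule bij_betw_byWitness)
  let ?C = "crossing ` set D"
  let ?F = "\<lambda>(g, x). (\<lambda>c. if c \<in> A then x else g c, x)"
  let ?G = "\<lambda>(h, x). (restrict h ?C, x)"
  have F: "?F (g, x) \<in> closed_colourings Q act E" if gx: "(g, x) \<in> closed_colourings Q act D" for g x
  proof -
    let ?h = "\<lambda>c. if c \<in> A then x else g c"
    have "?h \<in> crossing ` set E \<rightarrow>\<^sub>E Q" "x \<in> Q" "\<forall>a\<in>A. ?h a = x"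
      using gx unfolding assms(2) by (auto simp: closed_colourings_def PiE_iff extensional_def)
    moreover have "transport act ?h D x = transport act g D x"
      by (rule transport_cong) (use assms(1) in auto)
    moreover have "compatible act ?h D x = compatible act g D x"
      by (rule compatible_cong) (use assms(1) in auto)
    ultimately show ?thesis
      using gx same[of ?h x] by (auto simp: closed_colourings_def)
  qed
  have G: "?G (h, x) \<in> closed_colourings Q act D" if hx: "(h, x) \<in> closed_colourings Q act E" for h x
  proof -
    have "compatible act h D x" "transport act h D x = x"
      using same[of h x] forced[of h x] hx by (auto simp: closed_colourings_def)
    moreover have "transport act (restrict h ?C) D x = transport act h D x"
      by (rule transport_cong) auto
    moreover have "compatible act (restrict h ?C) D x = compatible act h D x"
      by (rule compatible_cong) auto
    ultimately show ?thesis
      using hx assms(2) by (auto simp: closed_colourings_def)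
  qed
  show "?F ` closed_colourings Q act D \<subseteq> closed_colourings Q act E"
    "?G ` closed_colourings Q act E \<subseteq> closed_colourings Q act D"
    using F G by (auto simp only: image_subset_iff)
  show "\<forall>a \<in> closed_colourings Q act D. ?G (?F a) = a"
    using assms(1)
    by (auto simp: closed_colourings_def PiE_iff disjoint_iff intro!: extensionalityI[of _ ?C])
  show "\<forall>a \<in> closed_colourings Q act E. ?F (?G a) = a"
    using assms(2) forced
    by (auto simp: closed_colourings_def fun_eq_iff PiE_def extensional_def)
qed

lemma closed_R1:
  assumes "c \<notin> crossing ` set D"
  shows "card (closed_colourings Q act D) = card (closed_colourings Q act ([Over c s, Under c s] @ D))"
    and "card (closed_colourings Q act D) = card (closed_colourings Q act ([Under c s, Over c s] @ D))"
proof -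
  show "card (closed_colourings Q act D) = card (closed_colourings Q act ([Over c s, Under c s] @ D))"
    by (rule closed_new_crossings[of "{c}"]) (use assms in \<open>auto simp: act_idem\<close>)
  \<comment> \<open>With the under-passage first, the check reads \<open>act s x y = y\<close>,
    where \<open>y\<close> is the colour of the new over-strand. Undoing the action of
    \<open>y\<close> turns the left side into \<open>x\<close> and, by idempotence, the right side
    into \<open>y\<close>.\<close>
  have "x = y" if "x \<in> Q" "y \<in> Q" "act s x y = y" for x y
    using act_inverse[OF that(1,2), of s] act_idem[OF that(2)] that(3) by simp
  then show "card (closed_colourings Q act D) =
      card (closed_colourings Q act ([Under c s, Over c s] @ D))"
    by (intro closed_new_crossings[of "{c}"]) (use assms in \<open>auto simp: act_idem\<close>)
qed

text \<open>Both over-passages force the colour \<open>x\<close> on the new labels, so the two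
  under-passages act by the same element with opposite signs and cancel. They do so in either order,
  whence one lemma for parallel and antiparallel strands.\<close>

lemma closed_R2:
  assumes "{a, b} \<inter> crossing ` set (u @ v) = {}" and "W \<in> {[Under a s, Under b (\<not> s)], [Under b (\<not> s), Under a s]}"
  shows "card (closed_colourings Q act (u @ v)) =
    card (closed_colourings Q act ([Over a s, Over b (\<not> s)] @ u @ W @ v))"
proof (rule closed_new_crossings[of "{a, b}"])
  fix h x assume h: "h \<in> crossing ` set ([Over a s, Over b (\<not> s)] @ u @ W @ v) \<rightarrow>\<^sub>E Q" "x \<in> Q"
    "\<forall>a\<in>{a, b}. h a = x"
  have "transport act h u x \<in> Q"
    by (rule transport_closed) (use h in auto)
  then show "compatible act h ([Over a s, Over b (\<not> s)] @ u @ W @ v) x = compatible act h (u @ v) x \<and>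
      transport act h ([Over a s, Over b (\<not> s)] @ u @ W @ v) x = transport act h (u @ v) x"
    using assms(2) h by (auto simp: act_inverse act_inverse')
qed (use assms in auto)

text \<open>One-sided on purpose: the converse comes from applying the move backwards. Ranging over
  all start colours in \<open>Q\<close> makes the relation stable under concatenation.\<close>

definition simulates ::
  "('c \<Rightarrow> 'q) \<Rightarrow> ('c \<Rightarrow> 'q) \<Rightarrow> 'c passage list \<Rightarrow> 'c passage list \<Rightarrow> bool" where
  "simulates g h D E \<longleftrightarrow> (\<forall>x\<in>Q. compatible act g D x \<longrightarrow>
     compatible act h E x \<and> transport act h E x = transport act g D x)"

lemma simulates_append:
  assumes "simulates g h D E" "simulates g h D' E'" "\<And>c. c \<in> crossing ` set D \<Longrightarrow> g c \<in> Q"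
  shows "simulates g h (D @ D') (E @ E')"
  using assms transport_closed[of _ D g] by (auto simp: simulates_def)

lemma simulates_cong:
  assumes "\<And>c. c \<in> crossing ` set D \<Longrightarrow> g c = h c"
  shows "simulates g h D D"
  using transport_cong[of D g h, OF assms] compatible_cong[of D g h, OF assms]
  by (auto simp: simulates_def)

text \<open>
  In move III only the strand between the two crossings of the middle strand changes its colour: it
  passes to the other side of the top strand.
\<close>

definition recolour :: "bool \<Rightarrow> 'c \<Rightarrow> 'c \<Rightarrow> ('c \<Rightarrow> 'q) \<Rightarrow> 'c \<Rightarrow> 'q" where
  "recolour r a c g = g(c := act r (g c) (g a))"

text \<open>If \<open>u\<close> holds, \<open>g c\<close> is the colour behind the passage under
  \<open>a\<close>; in the reversed order \<open>c\<close> is met before that passage, so the action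
  of \<open>g a\<close> has to be undone. Otherwise \<open>c\<close> is met first, and the action
  has to be applied. This decides the sign \<open>r\<close>.\<close>

lemma simulates_middle:
  assumes "g a \<in> Q" "g c \<in> Q" "a \<noteq> c" "r = (if u then \<not> sa else sa)"
  shows "simulates g (recolour r a c g) (ordered u [Under a sa, Over c sc])
    (ordered (\<not> u) [Under a sa, Over c sc])"
proof (cases u)
  case True
  have "x = act (\<not> sa) (g c) (g a)" if "x \<in> Q" "act sa x (g a) = g c" for x
    using act_inverse[of x "g a" sa] assms that by simp
  with True assms show ?thesis
    by (auto simp: simulates_def recolour_def ordered_def act_inverse')
next
  case False
  with assms show ?thesis
    by (auto simp: simulates_def recolour_def ordered_def)
qed

text \<open>Exchanging the two under-passages is self-distributivity: acting by the top strand can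
  be moved past acting by \<open>c\<close> if the colour of \<open>c\<close> is itself carried past
  the top strand. The premise \<open>g b = g a\<close> holds because the top strand has one colour
  at both of its crossings.\<close>

lemma simulates_bottom:
  assumes "g a \<in> Q" "g c \<in> Q" "g b = g a" "a \<noteq> c" "b \<noteq> c" "r = (if d then \<not> sb else sb)"
  shows "simulates g (recolour r a c g) (ordered d [Under b sb, Under c sc])
    (ordered (\<not> d) [Under b sb, Under c sc])"
proof (cases d)
  case True
  have "act sb (act sc z (act (\<not> sb) (g c) (g a))) (g a) = act sc (act sb z (g a)) (g c)"
    if "z \<in> Q" for z
    using assms that by (simp add: act_distrib[of z _ "g a" sb sc] act_closed act_inverse')
  with True show ?thesis
    using assms by (auto simp: simulates_def recolour_def ordered_def)
next
  case False
  have "act sc (act sb z (g a)) (act sb (g c) (g a)) = act sb (act sc z (g c)) (g a)"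
    if "z \<in> Q" for z
    using assms that by (simp add: act_distrib[of z "g c" "g a" sb sc])
  with False show ?thesis
    using assms by (auto simp: simulates_def recolour_def ordered_def)
qed

text \<open>The middle strand determines \<open>r\<close> from \<open>p\<close> and
  \<open>sa\<close>, the bottom strand from \<open>q\<close> and \<open>sb\<close>; the triangle
  condition \<open>q = p \<longleftrightarrow> sa = sb\<close> says precisely that the two choices
  agree. The two quadruples are the two orders in which the middle and bottom strands can follow the
  top strand.\<close>

lemma closed_R3_forward:
  assumes D: "D = ordered t [Over a sa, Over b sb] @ u @ X @ v @ Y @ w"
    and E: "E = ordered (\<not> t) [Over a sa, Over b sb] @ u @ X' @ v @ Y' @ w"
    and XY: "(X, X', Y, Y') \<in>
      {(ordered p [Under a sa, Over c sc], ordered (\<not> p) [Under a sa, Over c sc],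
        ordered q [Under b sb, Under c sc], ordered (\<not> q) [Under b sb, Under c sc]),
       (ordered q [Under b sb, Under c sc], ordered (\<not> q) [Under b sb, Under c sc],
        ordered p [Under a sa, Over c sc], ordered (\<not> p) [Under a sa, Over c sc])}"
    and pq: "q = p \<longleftrightarrow> sa = sb" and r: "r = (if p then \<not> sa else sa)"
    and c: "c \<noteq> a" "c \<noteq> b" "c \<notin> crossing ` set (u @ v @ w)"
    and gx: "(g, x) \<in> closed_colourings Q act D"
  shows "(recolour r a c g, x) \<in> closed_colourings Q act E"
proof -
  let ?h = "recolour r a c g"
  have lab: "crossing ` set E = crossing ` set D"
    using XY unfolding D E by auto
  have mem: "{a, c} \<union> crossing ` set (u @ X @ v @ Y @ w) \<subseteq> crossing ` set D"
    using XY unfolding D by auto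
  have gQ: "g \<in> crossing ` set D \<rightarrow>\<^sub>E Q" and x: "x \<in> Q"
    using gx by (auto simp: closed_colourings_def)
  then have Q: "g l \<in> Q" if "l \<in> crossing ` set D" for l
    using that by auto
  have ab: "g a = x" "g b = x" and rest: "compatible act g (u @ X @ v @ Y @ w) x"
    "transport act g (u @ X @ v @ Y @ w) x = x"
    using gx unfolding closed_colourings_def D by (cases t; auto simp: ordered_def)+
  have same: "simulates g ?h s s" if "s \<in> {u, v, w}" for s
    by (rule simulates_cong) (use that c in \<open>auto simp: recolour_def\<close>)
  have M: "simulates g ?h (ordered p [Under a sa, Over c sc]) (ordered (\<not> p) [Under a sa, Over c sc])"
    by (rule simulates_middle) (use Q mem c r in auto)
  have B: "simulates g ?h (ordered q [Under b sb, Under c sc]) (ordered (\<not> q) [Under b sb, Under c sc])"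
    by (rule simulates_bottom) (use Q mem c r ab pq in auto)
  have "simulates g ?h X X'" "simulates g ?h Y Y'"
    using M B XY by auto
  then have "simulates g ?h (u @ X @ v @ Y @ w) (u @ X' @ v @ Y' @ w)"
    using Q mem by (intro simulates_append same) auto
  then have "compatible act ?h (u @ X' @ v @ Y' @ w) x"
    "transport act ?h (u @ X' @ v @ Y' @ w) x = x"
    using rest x by (auto simp: simulates_def)
  moreover have "?h a = x" "?h b = x"
    using ab c by (auto simp: recolour_def)
  moreover have "?h \<in> crossing ` set E \<rightarrow>\<^sub>E Q"
    using gQ mem Q unfolding lab recolour_def
    by (auto simp: PiE_iff extensional_def act_closed)
  ultimately show ?thesis
    using x unfolding closed_colourings_def E by (cases t) (auto simp: ordered_def)
qed

text \<open>Well-formedness confines the label \<open>c\<close> to its two passages in the triangle,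
  so changing \<open>g c\<close> cannot disturb \<open>u\<close>, \<open>v\<close> or
  \<open>w\<close>.\<close>

lemma closed_R3:
  assumes "triangle P M B"
    and wf: "wf_code D"
    and DE: "D = P @ u @ M @ v @ B @ w \<and> E = rev P @ u @ rev M @ v @ rev B @ w \<or>
      D = P @ u @ B @ v @ M @ w \<and> E = rev P @ u @ rev B @ v @ rev M @ w"
  shows "card (closed_colourings Q act D) = card (closed_colourings Q act E)"
proof -
  obtain a b c sa sb sc t p q where
    P: "P = ordered t [Over a sa, Over b sb]" and M: "M = ordered p [Under a sa, Over c sc]"
    and B: "B = ordered q [Under b sb, Under c sc]" and pq: "q = p \<longleftrightarrow> sa = sb"
    using assms(1) unfolding triangle_def by blast
  define r where "r = (if p then \<not> sa else sa)"
  have D_set: "set D = set (P @ M @ B @ u @ v @ w)"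
    using DE by auto
  have dist: "distinct (map crossing (filter is_Over D))" "distinct (map crossing (filter is_Under D))"
    using wf by (auto simp: wf_code_def)
  have c: "c \<noteq> a" "c \<noteq> b"
    using dist(1) DE unfolding P M B by auto
  have "c \<notin> crossing ` set (filter is_Over (u @ v @ w))"
    using dist(1) DE unfolding P M B by auto
  moreover have "c \<notin> crossing ` set (filter is_Under (u @ v @ w))"
    using dist(2) DE unfolding P M B by auto
  ultimately have c': "c \<notin> crossing ` set (u @ v @ w)"
    by (simp add: crossing_split[of "u @ v @ w"] del: set_append)
  have inverse: "recolour (\<not> r) a c (recolour r a c g) = g" if "g a \<in> Q" "g c \<in> Q" for r g
    using that c by (auto simp: recolour_def act_inverse)
  have aD: "a \<in> crossing ` set D" "c \<in> crossing ` set D"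
    unfolding D_set P M by auto
  have lab: "crossing ` set E = crossing ` set D"
    using DE by auto
  show ?thesis
  proof (rule bij_betw_same_card, rule bij_betw_byWitness)
    let ?F = "\<lambda>r (g, x). (recolour r a c g, x)"
    have forward: "(recolour r a c g, x) \<in> closed_colourings Q act E"
      if "(g, x) \<in> closed_colourings Q act D" for g x
    proof -
      from DE show ?thesis
      proof (elim disjE conjE)
        assume "D = P @ u @ M @ v @ B @ w" "E = rev P @ u @ rev M @ v @ rev B @ w"
        then show ?thesis
          unfolding P M B ordered_simps
          by (rule closed_R3_forward) (use pq r_def c c' that in auto)
      next
        assume "D = P @ u @ B @ v @ M @ w" "E = rev P @ u @ rev B @ v @ rev M @ w"
        then show ?thesis
          unfolding P M B ordered_simps
          by (rule closed_R3_forward) (use pq r_def c c' that in auto)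
      qed
    qed
    then show "?F r ` closed_colourings Q act D \<subseteq> closed_colourings Q act E"
      by auto
    \<comment> \<open>The slid triangle has the same shape with all three flags negated and the
      signs kept, so the forward lemma applies to it with \<open>r\<close> negated.\<close>
    have backward: "(recolour (\<not> r) a c g, x) \<in> closed_colourings Q act D"
      if "(g, x) \<in> closed_colourings Q act E" for g x
    proof -
      from DE show ?thesis
      proof (elim disjE conjE)
        assume "D = P @ u @ M @ v @ B @ w" "E = rev P @ u @ rev M @ v @ rev B @ w"
        then have "E = ordered (\<not> t) [Over a sa, Over b sb] @ u @ rev M @ v @ rev B @ w"
          "D = ordered (\<not> \<not> t) [Over a sa, Over b sb] @ u @ M @ v @ B @ w"
          by (simp_all add: P)
        then show ?thesis
          by (rule closed_R3_forward[where p = "\<not> p" and q = "\<not> q" and sc = sc])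
            (use pq r_def c c' that in \<open>auto simp: M B\<close>)
      next
        assume "D = P @ u @ B @ v @ M @ w" "E = rev P @ u @ rev B @ v @ rev M @ w"
        then have "E = ordered (\<not> t) [Over a sa, Over b sb] @ u @ rev B @ v @ rev M @ w"
          "D = ordered (\<not> \<not> t) [Over a sa, Over b sb] @ u @ B @ v @ M @ w"
          by (simp_all add: P)
        then show ?thesis
          by (rule closed_R3_forward[where p = "\<not> p" and q = "\<not> q" and sc = sc])
            (use pq r_def c c' that in \<open>auto simp: M B\<close>)
      qed
    qed
    then show "?F (\<not> r) ` closed_colourings Q act E \<subseteq> closed_colourings Q act D"
      by auto
    show "\<forall>z \<in> closed_colourings Q act D. ?F (\<not> r) (?F r z) = z"
      using aD inverse by (auto simp: closed_colourings_def)
    show "\<forall>z \<in> closed_colourings Q act E. ?F r (?F (\<not> r) z) = z"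
      using aD inverse[of _ "\<not> r"] unfolding closed_colourings_def lab by auto
  qed
qed

lemma closed_move:
  assumes "reidemeister_move D E" "wf_code D"
  shows "card (closed_colourings Q act D) = card (closed_colourings Q act E)"
  using assms
proof cases
  case (rotate u v)
  then show ?thesis using closed_rotate by auto
next
  case (relabel f)
  then show ?thesis using closed_relabel by auto
next
  case (R1_over c s)
  then show ?thesis using closed_R1 by auto
next
  case (R1_under c s)
  then show ?thesis using closed_R1 by auto
next
  case (R2_parallel a b u v s)
  then show ?thesis using closed_R2[of a b u v "[Under a s, Under b (\<not> s)]" s] by simp
next
  case (R2_antiparallel a b u v s)
  then show ?thesis using closed_R2[of a b u v "[Under b (\<not> s), Under a s]" s] by simp
next
  case (R3_TMB P Q' R u v w)
  then show ?thesis using assms(2) by (intro closed_R3) auto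
next
  case (R3_TBM P Q' R u v w)
  then show ?thesis using assms(2) by (intro closed_R3) auto
qed

lemma closed_knot_of:
  assumes "D \<in> knot_of D\<^sub>0"
  shows "card (closed_colourings Q act D) = card (closed_colourings Q act D\<^sub>0)"
proof -
  let ?R = "\<lambda>D E. knot_diagram D \<and> knot_diagram E \<and> reidemeister_move D E"
  have "equivclp ?R D\<^sub>0 D"
    using assms by (simp add: knot_of_def reidemeister_equivalent_def)
  then show ?thesis
  proof (induction rule: equivclp_induct)
    case (step E F)
    then show ?case
      using closed_move[of E F] closed_move[of F E] by (metis knot_diagram_def)
  qed simp
qed

end

section \<open>Matching transport along the code with colours of arcs\<close>

lemma compatible_iff:
  "compatible act g D x \<longleftrightarrow>
     (\<forall>p < length D. is_Over (D ! p) \<longrightarrow> transport act g (take p D) x = g (crossing (D ! p)))"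
proof (induction D arbitrary: x)
  case (Cons q D)
  then show ?case by (auto simp: less_Suc_eq_0_disj)
qed simp

lemma transport_filter_Under: "transport act g (filter is_Under D) x = transport act g D x"
  by (induction D arbitrary: x) auto

lemma take_filter: "filter P (take p D) = take (length (filter P (take p D))) (filter P D)"
  by (metis append_eq_conv_conj append_take_drop_id filter_append)

text \<open>Along the prefixes the count grows by at most one at a time, so no value is skipped.
  This supplies, for every arc, a position that is entered by it.\<close>

lemma length_filter_take_onto:
  "k \<le> length (filter P D) \<Longrightarrow> \<exists>p \<le> length D. length (filter P (take p D)) = k"
proof (induction D arbitrary: k)
  case (Cons q D)
  show ?case
  proof (cases k)
    case (Suc k')
    show ?thesis
    proof (cases "P q")
      case True
      then obtain p where "p \<le> length D" "length (filter P (take p D)) = k'"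
        using Cons.IH[of k'] Cons.prems Suc by auto
      with True Suc show ?thesis by (intro exI[of _ "Suc p"]) auto
    next
      case False
      then obtain p where "p \<le> length D" "length (filter P (take p D)) = k"
        using Cons.IH[of k] Cons.prems by auto
      with False show ?thesis by (intro exI[of _ "Suc p"]) auto
    qed
  qed (auto intro: exI[of _ 0])
qed simp

lemma distinct_map_filter_nth_eq:
  assumes "distinct (map f (filter P D))" "p < length D" "q < length D" "P (D ! p)" "P (D ! q)"
    "f (D ! p) = f (D ! q)"
  shows "p = q"
  using assms
proof (induction D arbitrary: p q)
  case (Cons r D)
  then show ?case
    by (cases p; cases q) (auto split: if_splits simp: image_iff in_set_conv_nth)
qed simp

lemma over_position_unique:
  assumes "wf_code D" "p < length D" "q < length D" "is_Over (D ! p)" "is_Over (D ! q)"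
    "crossing (D ! p) = crossing (D ! q)"
  shows "p = q"
  using assms distinct_map_filter_nth_eq[of crossing is_Over D] by (auto simp: wf_code_def)

lemma over_position_exists:
  assumes "wf_code D" "c \<in> crossing ` set D"
  shows "\<exists>p < length D. is_Over (D ! p) \<and> crossing (D ! p) = c"
proof -
  have wf: "\<forall>c s. Over c s \<in> set D \<longleftrightarrow> Under c s \<in> set D"
    using assms(1) by (simp add: wf_code_def)
  obtain p where "p \<in> set D" "crossing p = c"
    using assms(2) by auto
  then obtain s where "Over c s \<in> set D"
    using wf by - (cases p; auto)
  then obtain q where "q < length D" "D ! q = Over c s"
    by (auto simp: in_set_conv_nth)
  then show ?thesis by auto
qed

text \<open>\<open>other\<close> searches for the label alone. It has to find an over-passage
  because two under-passages with a common label occupy the same position.\<close>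

lemma other_Under:
  assumes "wf_code D" "p < length D" "is_Under (D ! p)"
  shows "other D p < length D" "is_Over (D ! other D p)" "crossing (D ! other D p) = crossing (D ! p)"
proof -
  let ?P = "\<lambda>q. q \<noteq> p \<and> crossing (D ! q) = crossing (D ! p)"
  obtain q where q: "q < length D" "is_Over (D ! q)" "crossing (D ! q) = crossing (D ! p)"
    using over_position_exists[OF assms(1), of "crossing (D ! p)"] assms(2) by auto
  have "q \<noteq> p"
    using q(2) assms(3) by (cases "D ! p") auto
  then have "find ?P [0..<length D] \<noteq> None"
    using q by (auto simp: find_None_iff)
  then obtain r where r: "find ?P [0..<length D] = Some r"
    by auto
  then have *: "r < length D" "?P r"
    by (auto simp: find_Some_iff)
  have "\<not> is_Under (D ! r)"
    using distinct_map_filter_nth_eq[of crossing is_Under D r p] * assms by (auto simp: wf_code_def)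
  then have "is_Over (D ! r)"
    by (cases "D ! r") auto
  with * r show "other D p < length D" "is_Over (D ! other D p)"
    "crossing (D ! other D p) = crossing (D ! p)"
    by (auto simp: other_def)
qed

lemma num_crossings_pos:
  assumes "wf_code D"
  shows "num_crossings D > 0"
proof -
  have wf: "D \<noteq> []" "\<forall>c s. Over c s \<in> set D \<longleftrightarrow> Under c s \<in> set D"
    using assms by (simp_all add: wf_code_def)
  then have "hd D \<in> set D"
    by simp
  then obtain c s where "Under c s \<in> set D"
    using wf(2) by - (cases "hd D"; auto)
  then have "Under c s \<in> set (filter is_Under D)"
    by simp
  then show ?thesis
    unfolding num_crossings_def by (rule length_pos_if_in_set)
qed

lemma arc_at_less: "wf_code D \<Longrightarrow> arc_at D p < num_crossings D"
  using num_crossings_pos by (auto simp: arc_at_def)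

text \<open>At the end of the code all under-passages have been counted, and the reduction in
  \<open>arc_at\<close> turns their number into 0: the last arc closes up with the first.\<close>

lemma arc_at_0: "arc_at D 0 = 0" "arc_at D (length D) = 0"
  by (auto simp: arc_at_def num_crossings_def)

lemma arc_at_Suc_Over: "p < length D \<Longrightarrow> is_Over (D ! p) \<Longrightarrow> arc_at D (Suc p) = arc_at D p"
  by (cases "D ! p") (auto simp: arc_at_def take_Suc_conv_app_nth)

definition arc_colouring ::
  "(bool \<Rightarrow> 'q \<Rightarrow> 'q \<Rightarrow> 'q) \<Rightarrow> gauss_code \<Rightarrow> (nat \<Rightarrow> 'q) \<times> 'q \<Rightarrow> nat \<Rightarrow> 'q" where
  "arc_colouring act D = (\<lambda>(g, x). \<lambda>k\<in>{..<num_crossings D}.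
     transport act g (take k (filter is_Under D)) x)"

lemma arc_colouring_arc_at:
  assumes "wf_code D" "(g, x) \<in> closed_colourings Q act D"
  shows "arc_colouring act D (g, x) (arc_at D p) = transport act g (take p D) x"
proof -
  let ?k = "length (filter is_Under (take p D))"
  have *: "transport act g (take p D) x = transport act g (take ?k (filter is_Under D)) x"
    by (metis take_filter transport_filter_Under)
  have "?k \<le> num_crossings D"
    unfolding num_crossings_def by (metis append_take_drop_id filter_append le_add1 length_append)
  then consider "?k < num_crossings D" | "?k = num_crossings D"
    by linarith
  then show ?thesis
  proof cases
    case 1
    then show ?thesis
      by (simp add: * arc_colouring_def arc_at_def)
  next
    \<comment> \<open>Behind the last under-passage the arc number has wrapped around to 0, and the
      closing condition identifies the transported colour with the base colour.\<close>
    case 2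
    then have "transport act g (take p D) x = x"
      using assms(2) unfolding *
      by (simp add: num_crossings_def transport_filter_Under closed_colourings_def)
    then show ?thesis
      using 2 num_crossings_pos[OF assms(1)] by (simp add: arc_colouring_def arc_at_def)
  qed
qed

context quandle
begin

text \<open>In the direction from arcs to transport, the over-colour of a label is read off at its
  over-passage and the base colour is that of arc 0. The checks at over-passages are then automatic,
  and each crossing relation is one step of transport.\<close>

lemma card_colourings:
  assumes wf: "wf_code D"
  shows "card (colourings Q (act True) (act False) D) = card (closed_colourings Q act D)"
proof -
  let ?C = "crossing ` set D"
  let ?A = "closed_colourings Q act D" and ?B = "colourings Q (act True) (act False) D"
  define over where "over c = (SOME p. p < length D \<and> is_Over (D ! p) \<and> crossing (D ! p) = c)" for c
  have over: "over c < length D \<and> is_Over (D ! over c) \<and> crossing (D ! over c) = c" if "c \<in> ?C" for c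
    unfolding over_def by (rule someI_ex) (use over_position_exists[OF wf that] in blast)
  have over_eq: "over (crossing (D ! p)) = p" if "p < length D" "is_Over (D ! p)" for p
    using over[of "crossing (D ! p)"] over_position_unique[OF wf] that by auto
  have over_other: "over (crossing (D ! p)) = other D p" if "p < length D" "is_Under (D ! p)" for p
    using over_eq[of "other D p"] other_Under[OF wf that] by auto
  let ?G = "\<lambda>X. (\<lambda>c\<in>?C. X (arc_at D (over c)), X 0)"
  note N = num_crossings_pos[OF wf]
  have F_mem: "arc_colouring act D (g, x) \<in> ?B" and GF: "?G (arc_colouring act D (g, x)) = (g, x)"
    if gx: "(g, x) \<in> ?A" for g x
  proof -
    let ?X = "arc_colouring act D (g, x)"
    have g: "g \<in> ?C \<rightarrow>\<^sub>E Q" and x: "x \<in> Q" and "compatible act g D x"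
      using gx by (auto simp: closed_colourings_def)
    then have over_transport: "transport act g (take p D) x = g (crossing (D ! p))"
      if "p < length D" "is_Over (D ! p)" for p
      using that by (auto simp: compatible_iff)
    note X = arc_colouring_arc_at[OF wf gx]
    have "?X (arc_at D (over c)) = g c" if "c \<in> ?C" for c
      using X[of "over c"] over[OF that] over_transport by auto
    moreover have "?X 0 = x"
      using X[of 0] by (simp add: arc_at_0)
    ultimately show "?G ?X = (g, x)"
      using g by (auto simp: PiE_iff intro!: extensionalityI[of _ ?C])
    have "transport act g (take k (filter is_Under D)) x \<in> Q" for k
      by (rule transport_closed) (use x g in \<open>auto dest!: in_set_takeD\<close>)
    then have "?X \<in> {..<num_crossings D} \<rightarrow>\<^sub>E Q"
      by (auto simp: arc_colouring_def)
    moreover have "?X (arc_at D (Suc p)) =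
        act (positive (D ! p)) (?X (arc_at D p)) (?X (arc_at D (other D p)))"
      if "p < length D" "is_Under (D ! p)" for p
      using other_Under[OF wf that] over_transport[of "other D p"] that
      by (simp add: X take_Suc_conv_app_nth)
    ultimately show "?X \<in> ?B"
      by (auto simp: colourings_def)
  qed
  have G_mem: "?G X \<in> ?A" and FG: "arc_colouring act D (?G X) = X" if X: "X \<in> ?B" for X
  proof -
    define g where "g = (\<lambda>c\<in>?C. X (arc_at D (over c)))"
    have GX: "?G X = (g, X 0)"
      by (simp add: g_def)
    have g: "g (crossing (D ! p)) = X (arc_at D (over (crossing (D ! p))))" if "p < length D" for p
      using that by (simp add: g_def)
    have PiE: "X \<in> {..<num_crossings D} \<rightarrow>\<^sub>E Q"
      using X by (auto simp: colourings_def)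
    have Under: "X (arc_at D (Suc p)) =
        act (positive (D ! p)) (X (arc_at D p)) (X (arc_at D (other D p)))"
      if "p < length D" "is_Under (D ! p)" for p
      using X that by (cases "positive (D ! p)") (auto simp: colourings_def)
    have XQ: "X (arc_at D p) \<in> Q" for p
      using PiE arc_at_less[OF wf] by blast
    have tr: "transport act g (take p D) (X 0) = X (arc_at D p)" if "p \<le> length D" for p
      using that
    proof (induction p)
      case 0
      then show ?case by (simp add: arc_at_0)
    next
      case (Suc p)
      then have p: "p < length D" "transport act g (take p D) (X 0) = X (arc_at D p)"
        by auto
      show ?case
      proof (cases "is_Under (D ! p)")
        case True
        then show ?thesis
          using p by (simp add: take_Suc_conv_app_nth g over_other Under)
      next
        case False
        then have "is_Over (D ! p)"
          by (cases "D ! p") auto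
        then show ?thesis
          using p False by (simp add: take_Suc_conv_app_nth arc_at_Suc_Over)
      qed
    qed
    have "compatible act g D (X 0)"
      unfolding compatible_iff using tr over_eq g by auto
    moreover have "transport act g D (X 0) = X 0"
      using tr[of "length D"] by (simp add: arc_at_0)
    ultimately show mem: "?G X \<in> ?A"
      unfolding GX using XQ XQ[of 0] by (auto simp: closed_colourings_def arc_at_0 g_def)
    show "arc_colouring act D (?G X) = X"
    proof (rule extensionalityI[of _ "{..<num_crossings D}"])
      fix k assume "k \<in> {..<num_crossings D}"
      then obtain p where p: "p \<le> length D" "arc_at D p = k"
        using length_filter_take_onto[of k is_Under D] by (auto simp: num_crossings_def arc_at_def)
      then show "arc_colouring act D (?G X) k = X k"
        using arc_colouring_arc_at[OF wf mem[unfolded GX], of p] tr[of p] by (simp add: GX)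
    qed (use PiE in \<open>auto simp: arc_colouring_def PiE_iff\<close>)
  qed
  have "bij_betw (arc_colouring act D) ?A ?B"
    by (rule bij_betw_byWitness[where f' = ?G]) (use F_mem GF G_mem FG in auto)
  then show ?thesis
    by (simp add: bij_betw_same_card)
qed

end

section \<open>Row reduction over Laurent polynomials\<close>

lemma var_mult: "var * var_inv = 1" "var_inv * var = 1"
  by (simp_all add: var_def var_inv_def mult_single)

abbreviation reaches :: "laurent mat \<Rightarrow> laurent mat \<Rightarrow> bool" where
  "reaches \<equiv> matrix_operation\<^sup>*\<^sup>*"

text \<open>The operations offer three factors; following -1 by each of them yields the other three,
  the factor 1 being -1 used twice.\<close>

lemma reaches_scale:
  assumes "i < dim_row A" "c \<in> {1, - 1, var, var_inv, - var, - var_inv}"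
  shows "reaches A (multrow i c A)"
proof -
  have scale: "reaches B (multrow i d B)" if "i < dim_row B" "d \<in> {var, var_inv, - 1}" for B d
    using that by (blast intro: scale_row)
  have "reaches A (multrow i d (multrow i (- 1) A))" if "d \<in> {var, var_inv, - 1}" for d
    using scale[of A "- 1"] scale[of "multrow i (- 1) A" d] that assms(1) by auto
  moreover have "multrow i d (multrow i (- 1) A) = multrow i (- d) A" for d
    by (intro eq_matI) (use assms(1) in auto)
  ultimately have "reaches A (multrow i (- d) A)" if "d \<in> {var, var_inv, - 1}" for d
    using that by metis
  from this[of var] this[of var_inv] this[of "- 1"] show ?thesis
    using assms scale by auto
qed

text \<open>Scaling the source row, adding it and scaling it back alters the multiplier but not the
  source row. This is how multipliers other than 1 are produced.\<close>

lemma addrow_conjugate: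
  fixes A :: "'a::comm_ring_1 mat"
  assumes "e * d = 1" "i < dim_row A" "j < dim_row A" "i \<noteq> j"
  shows "multrow j e (addrow p i j (multrow j d A)) = addrow (p * d) i j A"
proof -
  have "e * (d * x) = x" for x
    by (simp flip: mult.assoc add: assms(1))
  then show ?thesis
    using assms(2-4) by (intro eq_matI) (auto simp: mult.assoc)
qed

text \<open>Only plain addition of a row is an operation. The Laurent polynomials form the free
  abelian group on the monomials, so monomials and differences have to be treated: conjugation by
  \<open>var\<close> or \<open>var_inv\<close> shifts an exponent by one, and conjugation by -1
  turns addition into subtraction.\<close>

lemma reaches_addrow:
  assumes "i < dim_row A" "j < dim_row A" "i \<noteq> j"
  shows "reaches A (addrow p i j A)"
  using subset_UNIV assms
proof (induction p arbitrary: A rule: frag_induction)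
  case zero
  moreover have "addrow 0 i j A = A"
    by (intro eq_matI) auto
  ultimately show ?case by simp
next
  case (one k)
  then show ?case
  proof (induction k arbitrary: A rule: int_induct[where k = 0])
    case base
    then have "matrix_operation A (addrow 1 i j A)"
      by (intro add_row) auto
    then show ?case by simp
  next
    case (step1 k)
    let ?B = "multrow j var A"
    let ?C = "addrow (frag_of k) i j ?B"
    have "reaches A (multrow j var_inv ?C)"
      using reaches_scale[of j A var] reaches_scale[of j ?C var_inv] step1.IH[of ?B] step1.prems
      by auto
    moreover have "frag_of (k + 1) = frag_of k * var"
      by (simp add: var_def mult_single)
    then have "multrow j var_inv ?C = addrow (frag_of (k + 1)) i j A"
      using step1.prems by (simp add: addrow_conjugate var_mult)
    ultimately show ?case by simp
  next
    case (step2 k)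
    let ?B = "multrow j var_inv A"
    let ?C = "addrow (frag_of k) i j ?B"
    have "reaches A (multrow j var ?C)"
      using reaches_scale[of j A var_inv] reaches_scale[of j ?C var] step2.IH[of ?B] step2.prems
      by auto
    moreover have "frag_of (k - 1) = frag_of k * var_inv"
      by (simp add: var_inv_def mult_single)
    then have "multrow j var ?C = addrow (frag_of (k - 1)) i j A"
      using step2.prems by (simp add: addrow_conjugate var_mult)
    ultimately show ?case by simp
  qed
next
  case (diff a b)
  let ?A = "addrow a i j A"
  let ?B = "multrow j (- 1) ?A"
  let ?C = "addrow b i j ?B"
  have "reaches A (multrow j (- 1) ?C)"
    using diff.IH(1)[of A] reaches_scale[of j ?A "- 1"] diff.IH(2)[of ?B]
      reaches_scale[of j ?C "- 1"] diff.prems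
    by auto
  moreover have "multrow j (- 1) ?C = addrow (- b) i j ?A"
    using diff.prems by (simp add: addrow_conjugate)
  moreover have "addrow (- b) i j ?A = addrow (a - b) i j A"
    using diff.prems by (intro eq_matI) (auto simp: left_diff_distrib)
  ultimately show ?case by simp
qed

section \<open>Bulk forms of the matrix operations\<close>

lemma reaches_permute_rows:
  assumes "\<pi> permutes {..<N}" "A \<in> carrier_mat N M"
  shows "reaches A (mat N M (\<lambda>(i, j). A $$ (\<pi> i, j)))"
  using assms(1) finite_lessThan assms(2)
proof (induction arbitrary: A rule: permutes_induct)
  case id
  then have "mat N M (\<lambda>(i, j). A $$ (id i, j)) = A"
    by (intro eq_matI) auto
  then show ?case by simp
next
  case (swap a b \<pi>)
  then have "matrix_operation A (swaprows a b A)"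
    by (intro swap_rows) auto
  moreover have "reaches (swaprows a b A) (mat N M (\<lambda>(i, j). swaprows a b A $$ (\<pi> i, j)))"
    using swap by auto
  moreover have "mat N M (\<lambda>(i, j). swaprows a b A $$ (\<pi> i, j)) =
      mat N M (\<lambda>(i, j). A $$ ((transpose a b \<circ> \<pi>) i, j))"
    using swap permutes_in_image[OF swap(4)]
    by (intro eq_matI) (auto simp: transpose_def)
  ultimately show ?case by (metis converse_rtranclp_into_rtranclp)
qed

lemma reaches_permute_cols:
  assumes "\<pi> permutes {..<M}" "A \<in> carrier_mat N M"
  shows "reaches A (mat N M (\<lambda>(i, j). A $$ (i, \<pi> j)))"
  using assms(1) finite_lessThan assms(2)
proof (induction arbitrary: A rule: permutes_induct)
  case id
  then have "mat N M (\<lambda>(i, j). A $$ (i, id j)) = A"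
    by (intro eq_matI) auto
  then show ?case by simp
next
  case (swap a b \<pi>)
  then have "matrix_operation A (swapcols a b A)"
    by (intro swap_cols) auto
  moreover have "reaches (swapcols a b A) (mat N M (\<lambda>(i, j). swapcols a b A $$ (i, \<pi> j)))"
    using swap by auto
  moreover have "mat N M (\<lambda>(i, j). swapcols a b A $$ (i, \<pi> j)) =
      mat N M (\<lambda>(i, j). A $$ (i, (transpose a b \<circ> \<pi>) j))"
    using swap permutes_in_image[OF swap(4)]
    by (intro eq_matI) (auto simp: transpose_def)
  ultimately show ?case by (metis converse_rtranclp_into_rtranclp)
qed

lemma reaches_scale_rows:
  assumes "A \<in> carrier_mat N M" "\<And>i. i < N \<Longrightarrow> u i \<in> {1, - 1, var, var_inv, - var, - var_inv}"
  shows "reaches A (mat N M (\<lambda>(i, j). u i * A $$ (i, j)))"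
proof -
  have "reaches A (mat N M (\<lambda>(i, j). (if i < k then u i else 1) * A $$ (i, j)))" if "k \<le> N" for k
    using that
  proof (induction k)
    case 0
    have "mat N M (\<lambda>(i, j). (if i < 0 then u i else 1) * A $$ (i, j)) = A"
      using assms(1) by (intro eq_matI) auto
    then show ?case by simp
  next
    case (Suc k)
    let ?B = "mat N M (\<lambda>(i, j). (if i < k then u i else 1) * A $$ (i, j))"
    have "reaches A (multrow k (u k) ?B)"
      using Suc reaches_scale[of k ?B "u k"] assms(2)[of k] by auto
    moreover have "multrow k (u k) ?B = mat N M (\<lambda>(i, j). (if i < Suc k then u i else 1) * A $$ (i, j))"
      by (intro eq_matI) auto
    ultimately show ?case by simp
  qed
  from this[of N] have "reaches A (mat N M (\<lambda>(i, j). (if i < N then u i else 1) * A $$ (i, j)))"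
    by simp
  moreover have "mat N M (\<lambda>(i, j). (if i < N then u i else 1) * A $$ (i, j)) =
      mat N M (\<lambda>(i, j). u i * A $$ (i, j))"
    by (intro eq_matI) auto
  ultimately show ?thesis by simp
qed

lemma permutes_nth:
  assumes "distinct xs" "set xs = {..<N}"
  shows "(\<lambda>i. if i < N then xs ! i else i) permutes {..<N}"
proof (rule bij_imp_permutes)
  have "length xs = N"
    using distinct_card[OF assms(1)] assms(2) by simp
  then have "bij_betw ((!) xs) {..<N} {..<N}"
    using bij_betw_nth[OF assms(1)] assms(2) by simp
  then show "bij_betw (\<lambda>i. if i < N then xs ! i else i) {..<N} {..<N}"
    by (rule bij_betw_cong[THEN iffD1, rotated]) auto
qed auto

lemma reaches_rearrange:
  assumes "A \<in> carrier_mat N N"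
    and "distinct rs" "set rs = {..<N}" "distinct cs" "set cs = {..<N}"
    and "length us = N" "set us \<subseteq> {1, - 1, var, var_inv, - var, - var_inv}"
  shows "reaches A
    (mat_of_rows_list N (map2 (\<lambda>u r. map (\<lambda>c. u * A $$ (r, c)) cs) us rs))"
proof -
  have len: "length rs = N" "length cs = N"
    using distinct_card assms(2-5) by fastforce+
  have mem: "rs ! i < N" "cs ! i < N" if "i < N" for i
    using nth_mem[of i rs] nth_mem[of i cs] that len assms(3,5) by auto
  have us: "us ! i \<in> {1, - 1, var, var_inv, - var, - var_inv}" if "i < N" for i
    by (rule subsetD[OF assms(7)]) (use that assms(6) in auto)
  let ?p = "\<lambda>i. if i < N then rs ! i else i" and ?q = "\<lambda>i. if i < N then cs ! i else i"
  let ?B = "mat N N (\<lambda>(i, j). A $$ (?p i, j))"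
  let ?C = "mat N N (\<lambda>(i, j). ?B $$ (i, ?q j))"
  let ?D = "mat N N (\<lambda>(i, j). us ! i * ?C $$ (i, j))"
  have AB: "reaches A ?B"
    by (rule reaches_permute_rows[OF permutes_nth]) (use assms in auto)
  have BC: "reaches ?B ?C"
    by (rule reaches_permute_cols[OF permutes_nth]) (use assms in auto)
  have CD: "reaches ?C ?D"
    by (rule reaches_scale_rows) (simp, rule us)
  have "?D = mat_of_rows_list N (map2 (\<lambda>u r. map (\<lambda>c. u * A $$ (r, c)) cs) us rs)"
    unfolding mat_of_rows_list_def using assms(6) len by (intro eq_matI) (simp_all add: mem)
  with rtranclp_trans[OF rtranclp_trans[OF AB BC] CD] show ?thesis
    by simp
qed

definition add_rows :: "nat \<Rightarrow> ('a \<times> nat) list \<Rightarrow> 'a::ring list list \<Rightarrow> 'a list" where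
  "add_rows k ops R = foldl (\<lambda>r (c, l). map2 (\<lambda>x y. x + c * y) r (R ! l)) (R ! k) ops"

text \<open>The rows that are read differ from row \<open>k\<close>, so they may be taken from the
  original list \<open>R\<close> however far the accumulation has progressed.\<close>

lemma reaches_add_rows:
  assumes "k < length R" "\<And>r. r \<in> set R \<Longrightarrow> length r = M"
    and "\<And>c l. (c, l) \<in> set ops \<Longrightarrow> l < length R \<and> l \<noteq> k"
  shows "reaches (mat_of_rows_list M R) (mat_of_rows_list M (R[k := add_rows k ops R]))
    \<and> length (add_rows k ops R) = M"
  using assms(3)
proof (induction ops rule: rev_induct)
  case Nil
  then show ?case
    using assms(1,2) by (simp add: add_rows_def)
next
  case (snoc x ops)
  obtain c l where x: "x = (c, l)"
    by force
  then have l: "l < length R" "l \<noteq> k"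
    using snoc.prems by auto
  let ?r = "add_rows k ops R" and ?B = "mat_of_rows_list M (R[k := add_rows k ops R])"
  have r: "length ?r = M" "reaches (mat_of_rows_list M R) ?B"
    using snoc by auto
  have new: "add_rows k (ops @ [x]) R = map2 (\<lambda>x y. x + c * y) ?r (R ! l)"
    by (simp add: add_rows_def x)
  have "reaches ?B (addrow c k l ?B)"
    using l assms(1) by (intro reaches_addrow) (auto simp: mat_of_rows_list_def)
  moreover have "addrow c k l ?B = mat_of_rows_list M (R[k := add_rows k (ops @ [x]) R])"
    unfolding new using l assms(1) assms(2)[of "R ! l"] r(1)
    by (intro eq_matI) (auto simp: mat_of_rows_list_def nth_list_update algebra_simps)
  ultimately show ?case
    using r assms(2)[of "R ! l"] l unfolding new by auto
qed

section \<open>Counting solutions modulo \<open>n\<close>\<close>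

definition unit_power :: "int \<Rightarrow> int \<Rightarrow> int \<Rightarrow> int" where
  "unit_power m m' k = (if k \<ge> 0 then m ^ nat k else m' ^ nat (- k))"

text \<open>The values stay in the integers instead of a residue ring. Additivity is then exact,
  while multiplicativity holds modulo \<open>n\<close> once \<open>m * m'\<close> is congruent to
  1.\<close>

definition evaluate :: "int \<Rightarrow> int \<Rightarrow> laurent \<Rightarrow> int" where
  "evaluate m m' p = (\<Sum>k\<in>Poly_Mapping.keys p. Poly_Mapping.lookup p k * unit_power m m' k)"

lemma evaluate_superset:
  assumes "finite S" "Poly_Mapping.keys p \<subseteq> S"
  shows "evaluate m m' p = (\<Sum>k\<in>S. Poly_Mapping.lookup p k * unit_power m m' k)"
  unfolding evaluate_def
  by (rule sum.mono_neutral_left) (use assms in \<open>auto simp: in_keys_iff\<close>)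

lemma evaluate_add: "evaluate m m' (p + q) = evaluate m m' p + evaluate m m' q"
proof -
  let ?S = "Poly_Mapping.keys p \<union> Poly_Mapping.keys q"
  have "Poly_Mapping.keys (p + q) \<subseteq> ?S"
    by (rule Poly_Mapping.keys_add)
  then show ?thesis
    by (simp add: evaluate_superset[of ?S] lookup_add distrib_right sum.distrib)
qed

lemma evaluate_zero [simp]: "evaluate m m' 0 = 0"
  by (simp add: evaluate_def)

lemma evaluate_minus: "evaluate m m' (- p) = - evaluate m m' p"
  using evaluate_add[of m m' p "- p"] by simp

lemma evaluate_diff: "evaluate m m' (p - q) = evaluate m m' p - evaluate m m' q"
  using evaluate_add[of m m' p "- q"] by (simp add: evaluate_minus)

lemma evaluate_frag_of: "evaluate m m' (frag_of k) = unit_power m m' k"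
  by (simp add: evaluate_def)

lemma evaluate_one [simp]: "evaluate m m' 1 = 1"
  using evaluate_frag_of[of m m' 0] by (simp add: unit_power_def)

lemma evaluate_var [simp]: "evaluate m m' var = m" "evaluate m m' var_inv = m'"
  using evaluate_frag_of[of m m' 1] evaluate_frag_of[of m m' "- 1"]
  by (simp_all add: unit_power_def var_def var_inv_def)

lemmas evaluate_simps = evaluate_add evaluate_minus evaluate_diff

lemma length_under_positions: "length (under_positions D) = num_crossings D"
proof -
  have "filter is_Under D = map ((!) D) (under_positions D)"
    unfolding under_positions_def filter_map[unfolded comp_def, symmetric] by (simp add: map_nth)
  then show ?thesis
    by (simp add: num_crossings_def)
qed

locale invertible_mod =
  fixes n :: nat and m m' :: int
  assumes n_pos: "n > 0" and inverse: "[m * m' = 1] (mod int n)"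
begin

lemma unit_power_Suc: "[unit_power m m' (k + 1) = m * unit_power m m' k] (mod int n)"
proof (cases "k \<ge> 0")
  case True
  then show ?thesis by (simp add: unit_power_def nat_add_distrib)
next
  case False
  \<comment> \<open>Writing the negative exponent as \<open>- 1 - int j\<close> exposes one factor
    \<open>m'\<close> for \<open>m\<close> to cancel; for nonnegative exponents the congruence is an
    equality.\<close>
  define j where "j = nat (- k - 1)"
  have k: "k = - 1 - int j"
    using False by (simp add: j_def)
  have "[(m * m') * m' ^ j = 1 * m' ^ j] (mod int n)"
    by (intro cong_mult inverse cong_refl)
  moreover have "unit_power m m' (k + 1) = m' ^ j" "unit_power m m' k = m' * m' ^ j"
    by (auto simp: unit_power_def k nat_add_distrib)
  ultimately show ?thesis
    by (simp add: cong_sym mult.assoc)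
qed

lemma unit_power_pred: "[unit_power m m' (k - 1) = m' * unit_power m m' k] (mod int n)"
proof -
  have "[m' * unit_power m m' k = m' * (m * unit_power m m' (k - 1))] (mod int n)"
    using unit_power_Suc[of "k - 1"] by (simp add: cong_scalar_left)
  moreover have "[(m * m') * unit_power m m' (k - 1) = 1 * unit_power m m' (k - 1)] (mod int n)"
    by (intro cong_mult inverse cong_refl)
  ultimately show ?thesis
    by (auto simp: ac_simps intro: cong_sym cong_trans)
qed

lemma unit_power_add:
  "[unit_power m m' (k + l) = unit_power m m' k * unit_power m m' l] (mod int n)"
proof (induction l rule: int_induct[where k = 0])
  case base
  then show ?case by (simp add: unit_power_def)
next
  case (step1 l)
  have "[unit_power m m' (k + (l + 1)) = m * unit_power m m' (k + l)] (mod int n)"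
    using unit_power_Suc[of "k + l"] by (simp add: add.assoc)
  also have "[m * unit_power m m' (k + l) = m * (unit_power m m' k * unit_power m m' l)] (mod int n)"
    by (intro cong_mult cong_refl step1.IH)
  also have "m * (unit_power m m' k * unit_power m m' l) = unit_power m m' k * (m * unit_power m m' l)"
    by simp
  also have "[\<dots> = unit_power m m' k * unit_power m m' (l + 1)] (mod int n)"
    by (intro cong_mult cong_refl cong_sym[OF unit_power_Suc])
  finally show ?case .
next
  case (step2 l)
  have "[unit_power m m' (k + (l - 1)) = m' * unit_power m m' (k + l)] (mod int n)"
    using unit_power_pred[of "k + l"] by (simp add: add_diff_eq)
  also have "[m' * unit_power m m' (k + l) = m' * (unit_power m m' k * unit_power m m' l)] (mod int n)"
    by (intro cong_mult cong_refl step2.IH)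
  also have "m' * (unit_power m m' k * unit_power m m' l) = unit_power m m' k * (m' * unit_power m m' l)"
    by simp
  also have "[\<dots> = unit_power m m' k * unit_power m m' (l - 1)] (mod int n)"
    by (intro cong_mult cong_refl cong_sym[OF unit_power_pred])
  finally show ?case .
qed

text \<open>Both sides are additive in each factor, which leaves monomials, where the claim is the
  addition of exponents.\<close>

lemma evaluate_mult: "[evaluate m m' (p * q) = evaluate m m' p * evaluate m m' q] (mod int n)"
proof (induction q rule: frag_induction[OF subset_UNIV])
  case 1
  then show ?case by simp
next
  case (2 k)
  show ?case
  proof (induction p rule: frag_induction[OF subset_UNIV])
    case 1
    then show ?case by simp
  next
    case (2 l)
    then show ?case
      using unit_power_add[of l k] by (simp add: evaluate_frag_of mult_single)
  next
    case (3 a b)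
    then show ?case
      by (simp add: left_diff_distrib evaluate_diff cong_diff)
  qed
next
  case (3 a b)
  then show ?case
    by (simp add: right_diff_distrib evaluate_diff cong_diff)
qed

lemma evaluate_coprime:
  assumes "c \<in> {var, var_inv, - 1}"
  shows "coprime (evaluate m m' c) (int n)"
proof -
  have "coprime m (int n)" "coprime m' (int n)"
    unfolding coprime_iff_invertible_int using inverse by (auto simp: mult.commute)
  then show ?thesis
    using assms by (auto simp: evaluate_minus)
qed

section \<open>Solution counts under the matrix operations\<close>

definition solutions :: "laurent mat \<Rightarrow> (nat \<Rightarrow> int) set" where
  "solutions A = {X \<in> {..<dim_col A} \<rightarrow>\<^sub>E {0..<int n}.
     \<forall>i < dim_row A. int n dvd (\<Sum>j<dim_col A. evaluate m m' (A $$ (i, j)) * X j)}"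

text \<open>Among the operations, this one changes the solutions themselves, by permuting their
  coordinates. Hence the invariant is their number and not the solution set.\<close>

lemma card_solutions_swapcols:
  assumes "k < dim_col A" "l < dim_col A"
  shows "card (solutions (swapcols k l A)) = card (solutions A)"
proof -
  let ?F = "\<lambda>X :: nat \<Rightarrow> int. X \<circ> transpose k l"
  have mem: "?F X \<in> solutions (swapcols k l B)"
    if "X \<in> solutions B" "dim_col B = dim_col A" for X B
  proof -
    have bij: "bij_betw (transpose k l) {..<dim_col B} {..<dim_col B}"
      using assms that(2) permutes_imp_bij[OF permutes_swap_id] by auto
    have "(\<Sum>j<dim_col B. evaluate m m' (swapcols k l B $$ (i, j)) * X (transpose k l j)) =
        (\<Sum>j<dim_col B. evaluate m m' (B $$ (i, j)) * X j)" if "i < dim_row B" for i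
    proof -
      have "(\<Sum>j<dim_col B. evaluate m m' (swapcols k l B $$ (i, j)) * X (transpose k l j)) =
          (\<Sum>j<dim_col B. evaluate m m' (B $$ (i, transpose k l j)) * X (transpose k l j))"
        using that by (intro sum.cong) (auto simp: transpose_def)
      also have "\<dots> = (\<Sum>j<dim_col B. evaluate m m' (B $$ (i, j)) * X j)"
        by (rule sum.reindex_bij_betw[OF bij])
      finally show ?thesis .
    qed
    moreover have "?F X \<in> {..<dim_col B} \<rightarrow>\<^sub>E {0..<int n}"
      using that assms by (auto simp: solutions_def PiE_iff extensional_def transpose_def)
    ultimately show ?thesis
      using that(1) by (auto simp: solutions_def)
  qed
  have twice: "swapcols k l (swapcols k l A) = A"
    by (intro eq_matI) (use assms in auto)
  have "bij_betw ?F (solutions A) (solutions (swapcols k l A))"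
    by (rule bij_betw_byWitness[where f' = ?F])
      (use mem[of _ A] mem[of _ "swapcols k l A"] in \<open>auto simp: twice comp_assoc\<close>)
  then show ?thesis by (simp add: bij_betw_same_card)
qed

lemma solutions_multrow:
  assumes "k < dim_row A" "c \<in> {var, var_inv, - 1}"
  shows "solutions (multrow k c A) = solutions A"
proof -
  have "int n dvd (\<Sum>j<dim_col A. evaluate m m' (c * A $$ (k, j)) * X j) \<longleftrightarrow>
      int n dvd (\<Sum>j<dim_col A. evaluate m m' (A $$ (k, j)) * X j)" for X
  proof -
    have "[(\<Sum>j<dim_col A. evaluate m m' (c * A $$ (k, j)) * X j) =
        (\<Sum>j<dim_col A. evaluate m m' c * evaluate m m' (A $$ (k, j)) * X j)] (mod int n)"
      by (intro cong_sum cong_mult cong_refl evaluate_mult)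
    moreover have "(\<Sum>j<dim_col A. evaluate m m' c * evaluate m m' (A $$ (k, j)) * X j) =
        evaluate m m' c * (\<Sum>j<dim_col A. evaluate m m' (A $$ (k, j)) * X j)"
      by (simp add: sum_distrib_left mult.assoc)
    ultimately show ?thesis
      using evaluate_coprime[OF assms(2)]
      by (simp add: cong_dvd_iff coprime_dvd_mult_right_iff coprime_commute)
  qed
  then have "(int n dvd (\<Sum>j<dim_col A. evaluate m m' (multrow k c A $$ (i, j)) * X j)) =
      (int n dvd (\<Sum>j<dim_col A. evaluate m m' (A $$ (i, j)) * X j))" if "i < dim_row A" for i X
    using that by (cases "i = k") auto
  then show ?thesis
    by (auto simp: solutions_def)
qed

lemma solutions_addrow:
  assumes "k < dim_row A" "l < dim_row A" "k \<noteq> l"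
  shows "solutions (addrow 1 k l A) = solutions A"
proof -
  have sum: "(\<Sum>j<dim_col A. evaluate m m' (addrow 1 k l A $$ (i, j)) * X j) =
      (if i = k then (\<Sum>j<dim_col A. evaluate m m' (A $$ (l, j)) * X j) else 0) +
      (\<Sum>j<dim_col A. evaluate m m' (A $$ (i, j)) * X j)" if "i < dim_row A" for i X
    using that by (auto simp: evaluate_add distrib_right sum.distrib)
  show ?thesis
  proof (intro Set.set_eqI iffI)
    fix X assume X: "X \<in> solutions (addrow 1 k l A)"
    \<comment> \<open>Row \<open>l\<close> is left alone by the operation, so its relation is
      available to be subtracted from the altered row \<open>k\<close>.\<close>
    then have "int n dvd (\<Sum>j<dim_col A. evaluate m m' (A $$ (l, j)) * X j)"
      using sum[of l X] assms by (auto simp: solutions_def)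
    then have "int n dvd (\<Sum>j<dim_col A. evaluate m m' (A $$ (i, j)) * X j)" if "i < dim_row A" for i
      using X sum[OF that, of X] that by (auto simp: solutions_def dvd_add_right_iff split: if_splits)
    then show "X \<in> solutions A"
      using X by (auto simp: solutions_def)
  next
    fix X assume "X \<in> solutions A"
    then show "X \<in> solutions (addrow 1 k l A)"
      using sum[of _ X] assms by (auto simp: solutions_def simp del: index_mat_addrow(1))
  qed
qed

lemma solutions_swaprows:
  assumes "k < dim_row A" "l < dim_row A"
  shows "solutions (swaprows k l A) = solutions A"
proof -
  have row: "(\<Sum>j<dim_col A. evaluate m m' (swaprows k l A $$ (i, j)) * X j) =
      (\<Sum>j<dim_col A. evaluate m m' (A $$ (transpose k l i, j)) * X j)" if "i < dim_row A" for i X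
    using that by (intro sum.cong) (auto simp: transpose_def)
  have "transpose k l i < dim_row A" if "i < dim_row A" for i
    using that assms by (auto simp: transpose_def)
  then have swap: "(\<forall>i<dim_row A. P (transpose k l i)) \<longleftrightarrow> (\<forall>i<dim_row A. P i)" for P
    by (metis transpose_involutory)
  have "(\<forall>i<dim_row A. int n dvd (\<Sum>j<dim_col A. evaluate m m' (swaprows k l A $$ (i, j)) * X j)) \<longleftrightarrow>
      (\<forall>i<dim_row A. int n dvd (\<Sum>j<dim_col A. evaluate m m' (A $$ (i, j)) * X j))" for X
    unfolding swap[of "\<lambda>i. int n dvd (\<Sum>j<dim_col A. evaluate m m' (A $$ (i, j)) * X j)", symmetric]
    by (simp add: row del: index_mat_swaprows(1))
  then show ?thesis
    by (simp add: solutions_def del: index_mat_swaprows(1))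
qed

lemma card_solutions_operation:
  assumes "matrix_operation A B"
  shows "card (solutions B) = card (solutions A)"
  using assms
proof cases
  case (scale_row i c)
  then show ?thesis by (simp only: solutions_multrow)
next
  case (add_row i j)
  then show ?thesis using solutions_addrow by simp
next
  case (swap_rows i j)
  then show ?thesis using solutions_swaprows by simp
next
  case (swap_cols i j)
  then show ?thesis by (simp only: card_solutions_swapcols)
qed

lemma card_solutions_reaches: "reaches A B \<Longrightarrow> card (solutions B) = card (solutions A)"
  by (induction rule: rtranclp_induct) (auto simp: card_solutions_operation)

text \<open>Once the inner reductions are removed by congruence, distributivity is a polynomial
  identity and the inverse law reads \<open>(a * b) * (x - y) + y = x\<close>. Equality instead of
  mere congruence with \<open>x\<close> comes from \<open>x\<close> being reduced already.\<close>

lemma quandle_alexander: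
  "quandle {0..<int n} (\<lambda>s. alexander_op n (if s then m else m'))"
proof
  fix x y z :: int and s r :: bool
  assume x: "x \<in> {0..<int n}"
  show "alexander_op n (if s then m else m') x y \<in> {0..<int n}" if "y \<in> {0..<int n}"
    using n_pos by (simp add: alexander_op_def)
  show "alexander_op n (if s then m else m') x x = x"
    using x by (simp add: alexander_op_def algebra_simps)
  have op: "[alexander_op n a x y = a * x + (1 - a) * y] (mod int n)" for a x y
    by (simp add: alexander_op_def cong_def)
  have distrib: "alexander_op n a (alexander_op n b x y) z =
      alexander_op n b (alexander_op n a x z) (alexander_op n a y z)" for a b
  proof -
    have "[a * alexander_op n b x y + (1 - a) * z =
        a * (b * x + (1 - b) * y) + (1 - a) * z] (mod int n)"
      by (intro cong_add cong_mult cong_refl op)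
    also have "a * (b * x + (1 - b) * y) + (1 - a) * z =
        b * (a * x + (1 - a) * z) + (1 - b) * (a * y + (1 - a) * z)"
      by (simp add: algebra_simps)
    also have "[\<dots> = b * alexander_op n a x z + (1 - b) * alexander_op n a y z] (mod int n)"
      by (intro cong_add cong_mult cong_refl cong_sym[OF op])
    finally show ?thesis
      unfolding alexander_op_def[of n a "alexander_op n b x y"] alexander_op_def[of n b "alexander_op n a x z"]
      by (simp only: cong_def)
  qed
  have undo: "alexander_op n b (alexander_op n a x y) y = x" if "[a * b = 1] (mod int n)" for a b
  proof -
    have "[b * alexander_op n a x y + (1 - b) * y =
        b * (a * x + (1 - a) * y) + (1 - b) * y] (mod int n)"
      by (intro cong_add cong_mult cong_refl op)
    also have "b * (a * x + (1 - a) * y) + (1 - b) * y = (a * b) * (x - y) + y"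
      by (simp add: algebra_simps)
    also have "[(a * b) * (x - y) + y = 1 * (x - y) + y] (mod int n)"
      by (intro cong_add cong_mult that cong_refl)
    finally show ?thesis
      using x unfolding alexander_op_def[of n b] by (simp add: cong_def)
  qed
  show "alexander_op n (if \<not> s then m else m') (alexander_op n (if s then m else m') x y) y = x"
    using undo[of m m'] undo[of m' m] inverse by (cases s) (simp_all add: mult.commute)
  show "alexander_op n (if s then m else m') (alexander_op n (if r then m else m') x y) z =
      alexander_op n (if r then m else m') (alexander_op n (if s then m else m') x z)
        (alexander_op n (if s then m else m') y z)"
    by (rule distrib)
qed

text \<open>A row of the matrix states a crossing relation as a congruence. Colours are residues in
  \<open>{0..<int n}\<close>, so the congruence is an equality with the reduced value, and the two
  sets coincide.\<close>

lemma colourings_eq_solutions: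
  assumes wf: "wf_code D"
  shows "colourings {0..<int n} (alexander_op n m) (alexander_op n m') D = solutions (colouring_matrix D)"
proof -
  let ?N = "num_crossings D"
  have key: "(\<forall>p<length D. is_Under (D ! p) \<longrightarrow> X (arc_at D (Suc p)) =
        (if positive (D ! p) then alexander_op n m else alexander_op n m') (X (arc_at D p)) (X (arc_at D (other D p))))
      \<longleftrightarrow> (\<forall>r<?N. int n dvd (\<Sum>k<?N. evaluate m m' (colouring_matrix D $$ (r, k)) * X k))"
    if X: "X \<in> {..<?N} \<rightarrow>\<^sub>E {0..<int n}" for X
  proof -
    have row: "int n dvd (\<Sum>k<?N. evaluate m m' (colouring_matrix D $$ (r, k)) * X k) \<longleftrightarrow>
        X (arc_at D (Suc p)) =
          (if positive (D ! p) then alexander_op n m else alexander_op n m') (X (arc_at D p)) (X (arc_at D (other D p)))"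
      if r: "r < ?N" and p: "p = under_positions D ! r" for r p
    proof -
      let ?t = "if positive (D ! p) then m else m'"
      let ?i = "arc_at D p" and ?j = "arc_at D (other D p)" and ?k = "arc_at D (Suc p)"
      \<comment> \<open>The three contributions stay separate, so coinciding arcs, whose
        coefficients add up in the matrix, call for no case distinction.\<close>
      have "evaluate m m' (colouring_matrix D $$ (r, k)) * X k =
          (if k = ?i then ?t * X k else 0) + (if k = ?j then (1 - ?t) * X k else 0) - (if k = ?k then X k else 0)"
        if "k < ?N" for k
        using r that by (simp add: colouring_matrix_def p[symmetric] Let_def evaluate_simps distrib_right)
      then have "(\<Sum>k<?N. evaluate m m' (colouring_matrix D $$ (r, k)) * X k) =
          (\<Sum>k<?N. (if k = ?i then ?t * X k else 0) + (if k = ?j then (1 - ?t) * X k else 0) - (if k = ?k then X k else 0))"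
        by (intro sum.cong) auto
      also have "\<dots> = ?t * X ?i + (1 - ?t) * X ?j - X ?k"
        using arc_at_less[OF wf] by (simp add: sum.distrib sum_subtractf)
      finally have "int n dvd (\<Sum>k<?N. evaluate m m' (colouring_matrix D $$ (r, k)) * X k) \<longleftrightarrow>
          (?t * X ?i + (1 - ?t) * X ?j) mod int n = X ?k mod int n"
        by (simp add: mod_eq_dvd_iff)
      moreover have "X ?k \<in> {0..<int n}"
        using X arc_at_less[OF wf] by blast
      ultimately show ?thesis
        by (auto simp: alexander_op_def)
    qed
    have "(\<forall>p<length D. is_Under (D ! p) \<longrightarrow> P p) \<longleftrightarrow> (\<forall>r<?N. P (under_positions D ! r))" for P
    proof -
      have "(\<forall>p<length D. is_Under (D ! p) \<longrightarrow> P p) \<longleftrightarrow> (\<forall>p\<in>set (under_positions D). P p)"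
        by (auto simp: under_positions_def)
      then show ?thesis
        by (simp add: all_set_conv_all_nth length_under_positions)
    qed
    then show ?thesis
      using row by simp
  qed
  have dims: "dim_row (colouring_matrix D) = ?N" "dim_col (colouring_matrix D) = ?N"
    by (simp_all add: colouring_matrix_def)
  show ?thesis
    unfolding colourings_def solutions_def dims by (rule Collect_cong) (use key in blast)
qed

section \<open>Eliminating unit pivots and counting the remaining block\<close>

definition tail_solutions :: "(nat \<Rightarrow> nat \<Rightarrow> int) \<Rightarrow> nat \<Rightarrow> nat \<Rightarrow> (nat \<Rightarrow> int) set" where
  "tail_solutions a r N = {X \<in> {r..<N} \<rightarrow>\<^sub>E {0..<int n}.
     \<forall>i\<in>{r..<N}. int n dvd (\<Sum>j\<in>{r..<N}. a i j * X j)}"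

text \<open>The unit pivot solves row \<open>r\<close> for \<open>X r\<close> in terms of later
  coordinates, and the zeros below it keep \<open>X r\<close> out of the other rows. Restriction and
  this unique extension are mutually inverse.\<close>

lemma card_tail_solutions_Suc:
  assumes "r < N" "a r r = 1" "\<And>i. r < i \<Longrightarrow> i < N \<Longrightarrow> a i r = 0"
  shows "card (tail_solutions a r N) = card (tail_solutions a (Suc r) N)"
proof -
  let ?T = "{Suc r..<N}"
  have ins: "{r..<N} = insert r ?T"
    using assms(1) by auto
  let ?F = "\<lambda>X. restrict X ?T"
  let ?s = "\<lambda>Y. (- (\<Sum>j\<in>?T. a r j * Y j)) mod int n"
  let ?G = "\<lambda>Y. Y(r := ?s Y)"
  have s: "int n dvd (x + (\<Sum>j\<in>?T. a r j * Y j)) \<longleftrightarrow> x = ?s Y" if "x \<in> {0..<int n}" for x Y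
  proof -
    have "int n dvd (x - (- (\<Sum>j\<in>?T. a r j * Y j))) \<longleftrightarrow> x mod int n = ?s Y"
      by (rule mod_eq_dvd_iff[symmetric])
    then show ?thesis
      using that by simp
  qed
  have mem_iff: "X \<in> tail_solutions a r N \<longleftrightarrow>
      X \<in> {r..<N} \<rightarrow>\<^sub>E {0..<int n} \<and> X r = ?s X \<and>
      (\<forall>i\<in>?T. int n dvd (\<Sum>j\<in>?T. a i j * X j))" for X
    using assms s[of "X r" X] unfolding tail_solutions_def ins by (auto simp: PiE_iff)
  have F: "?F X \<in> tail_solutions a (Suc r) N" if "X \<in> tail_solutions a r N" for X
    using that unfolding mem_iff by (auto simp: tail_solutions_def)
  have G: "?G Y \<in> tail_solutions a r N" if Y: "Y \<in> tail_solutions a (Suc r) N" for Y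
  proof -
    have "(\<Sum>j\<in>?T. a i j * (?G Y) j) = (\<Sum>j\<in>?T. a i j * Y j)" for i
      by (intro sum.cong) auto
    moreover have "?s Y \<in> {0..<int n}"
      using n_pos by simp
    ultimately show ?thesis
      using Y assms(1) unfolding mem_iff by (auto simp: tail_solutions_def PiE_iff extensional_def)
  qed
  have "bij_betw ?F (tail_solutions a r N) (tail_solutions a (Suc r) N)"
  proof (rule bij_betw_byWitness[where f' = ?G])
    show "\<forall>X\<in>tail_solutions a r N. ?G (?F X) = X"
      by (auto simp: mem_iff fun_eq_iff PiE_iff extensional_def)
    show "\<forall>Y\<in>tail_solutions a (Suc r) N. ?F (?G Y) = Y"
      by (auto simp: tail_solutions_def fun_eq_iff PiE_iff extensional_def)
  qed (use F G in auto)
  then show ?thesis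
    by (rule bij_betw_same_card)
qed

lemma card_solutions_tail:
  assumes "A \<in> carrier_mat N N" "upper_triangular A" "\<forall>i<r. A $$ (i, i) = 1" "r \<le> N"
  shows "card (solutions A) = card (tail_solutions (\<lambda>i j. evaluate m m' (A $$ (i, j))) r N)"
  using assms(3,4)
proof (induction r)
  case 0
  have "solutions A = tail_solutions (\<lambda>i j. evaluate m m' (A $$ (i, j))) 0 N"
    using assms(1) by (auto simp: solutions_def tail_solutions_def lessThan_atLeast0)
  then show ?case by simp
next
  case (Suc r)
  have "A $$ (i, r) = 0" if "r < i" "i < N" for i
    using upper_triangularD[OF assms(2) that(1)] that assms(1) by auto
  then show ?case
    using Suc card_tail_solutions_Suc[of r N "\<lambda>i j. evaluate m m' (A $$ (i, j))"] by auto
qed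

definition annihilator :: "int \<Rightarrow> int set" where
  "annihilator d = {w \<in> {0..<int n}. int n dvd d * w}"

lemma cong_shift: "[(u + z) mod int n - z = u] (mod int n)" "[u mod int n = u] (mod int n)"
  by (simp_all add: cong_def mod_simps)

text \<open>Only the difference of the two coordinates is constrained. The last coordinate is free,
  which gives the factor \<open>n\<close>.\<close>

lemma card_tail_solutions_type_I:
  assumes "a r r = \<alpha>" "a r (Suc r) = - \<alpha>" "a (Suc r) r = 0" "a (Suc r) (Suc r) = 0"
  shows "card (tail_solutions a r (Suc (Suc r))) = n * card (annihilator \<alpha>)"
proof -
  let ?Q = "{0..<int n}" and ?T = "tail_solutions a r (Suc (Suc r))"
  let ?F = "\<lambda>(y, w). \<lambda>j\<in>{r, Suc r}. if j = r then (w + y) mod int n else y"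
  let ?G = "\<lambda>X. (X (Suc r), (X r - X (Suc r)) mod int n)"
  have set: "{r..<Suc (Suc r)} = {r, Suc r}"
    by auto
  have mem_iff: "X \<in> ?T \<longleftrightarrow> X \<in> {r, Suc r} \<rightarrow>\<^sub>E ?Q \<and> int n dvd \<alpha> * (X r - X (Suc r))" for X
    unfolding tail_solutions_def set by (simp add: assms right_diff_distrib)
  have F: "?F p \<in> ?T" if mem: "p \<in> ?Q \<times> annihilator \<alpha>" for p
  proof -
    obtain y w where p: "p = (y, w)" "y \<in> ?Q" "w \<in> ?Q" "int n dvd \<alpha> * w"
      using mem by (auto simp: annihilator_def)
    have "[\<alpha> * ((w + y) mod int n - y) = \<alpha> * w] (mod int n)"
      by (intro cong_mult cong_refl cong_shift)
    then have "int n dvd \<alpha> * ((w + y) mod int n - y)"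
      using p(4) by (simp add: cong_dvd_iff)
    then show ?thesis
      using p(2) n_pos by (simp add: mem_iff p(1))
  qed
  have G: "?G X \<in> ?Q \<times> annihilator \<alpha>" if "X \<in> ?T" for X
  proof -
    have X: "X \<in> {r, Suc r} \<rightarrow>\<^sub>E ?Q" "int n dvd \<alpha> * (X r - X (Suc r))"
      using that by (simp_all only: mem_iff)
    have "[\<alpha> * ((X r - X (Suc r)) mod int n) = \<alpha> * (X r - X (Suc r))] (mod int n)"
      by (intro cong_mult cong_refl cong_shift)
    then have "int n dvd \<alpha> * ((X r - X (Suc r)) mod int n)"
      using X(2) by (simp add: cong_dvd_iff)
    then show ?thesis
      using X(1) n_pos by (auto simp: annihilator_def PiE_iff)
  qed
  have "bij_betw ?F (?Q \<times> annihilator \<alpha>) ?T"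
  proof (rule bij_betw_byWitness[where f' = ?G])
    show "\<forall>p\<in>?Q \<times> annihilator \<alpha>. ?G (?F p) = p"
      by (auto simp: annihilator_def mod_simps)
    show "\<forall>X\<in>?T. ?F (?G X) = X"
    proof
      fix X assume "X \<in> ?T"
      then have "X \<in> {r, Suc r} \<rightarrow>\<^sub>E ?Q"
        by (simp only: mem_iff)
      then show "?F (?G X) = X"
        by (auto simp: fun_eq_iff PiE_iff extensional_def mod_simps)
    qed
  qed (use F G in blast)+
  then show ?thesis
    by (simp add: bij_betw_same_card[symmetric] card_cartesian_product)
qed

text \<open>Every row sums to zero, so solutions can be translated by a constant. Splitting off the
  free last coordinate leaves the differences \<open>u\<close> and \<open>v\<close>.\<close>

lemma card_tail_solutions_type_II:
  assumes "a r r = \<alpha>\<^sub>1" "a r (Suc r) = \<beta>\<^sub>1" "a r (Suc (Suc r)) = - (\<alpha>\<^sub>1 + \<beta>\<^sub>1)"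
    and "a (Suc r) r = 0" "a (Suc r) (Suc r) = \<alpha>\<^sub>2" "a (Suc r) (Suc (Suc r)) = - \<alpha>\<^sub>2"
    and "a (Suc (Suc r)) r = 0" "a (Suc (Suc r)) (Suc r) = 0" "a (Suc (Suc r)) (Suc (Suc r)) = 0"
  shows "card (tail_solutions a r (Suc (Suc (Suc r)))) =
    n * card {(u, v) \<in> {0..<int n} \<times> {0..<int n}. int n dvd \<alpha>\<^sub>1 * u + \<beta>\<^sub>1 * v \<and> int n dvd \<alpha>\<^sub>2 * v}"
    (is "_ = n * card ?W")
proof -
  let ?Q = "{0..<int n}" and ?T = "tail_solutions a r (Suc (Suc (Suc r)))"
  let ?J = "{r, Suc r, Suc (Suc r)}"
  let ?F = "\<lambda>(z, u, v). \<lambda>j\<in>?J. if j = r then (u + z) mod int n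
    else if j = Suc r then (v + z) mod int n else z"
  let ?G = "\<lambda>X. (X (Suc (Suc r)), (X r - X (Suc (Suc r))) mod int n,
    (X (Suc r) - X (Suc (Suc r))) mod int n)"
  have set: "{r..<Suc (Suc (Suc r))} = ?J"
    by auto
  have mem_iff: "X \<in> ?T \<longleftrightarrow> X \<in> ?J \<rightarrow>\<^sub>E ?Q \<and>
      int n dvd \<alpha>\<^sub>1 * (X r - X (Suc (Suc r))) + \<beta>\<^sub>1 * (X (Suc r) - X (Suc (Suc r))) \<and>
      int n dvd \<alpha>\<^sub>2 * (X (Suc r) - X (Suc (Suc r)))" for X
    unfolding tail_solutions_def set by (simp add: assms algebra_simps)
  have F: "?F p \<in> ?T" if mem: "p \<in> ?Q \<times> ?W" for p
  proof -
    obtain z u v where p: "p = (z, u, v)" "z \<in> ?Q"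
      "int n dvd \<alpha>\<^sub>1 * u + \<beta>\<^sub>1 * v" "int n dvd \<alpha>\<^sub>2 * v"
      using mem by auto
    have "[\<alpha>\<^sub>1 * ((u + z) mod int n - z) + \<beta>\<^sub>1 * ((v + z) mod int n - z) = \<alpha>\<^sub>1 * u + \<beta>\<^sub>1 * v] (mod int n)"
      by (intro cong_add cong_mult cong_refl cong_shift)
    moreover have "[\<alpha>\<^sub>2 * ((v + z) mod int n - z) = \<alpha>\<^sub>2 * v] (mod int n)"
      by (intro cong_mult cong_refl cong_shift)
    ultimately have "int n dvd \<alpha>\<^sub>1 * ((u + z) mod int n - z) + \<beta>\<^sub>1 * ((v + z) mod int n - z)"
      "int n dvd \<alpha>\<^sub>2 * ((v + z) mod int n - z)"
      using p(3,4) by (simp_all only: cong_dvd_iff)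
    then show ?thesis
      using p(2) n_pos by (simp add: mem_iff p(1))
  qed
  have G: "?G X \<in> ?Q \<times> ?W" if "X \<in> ?T" for X
  proof -
    let ?x = "X r - X (Suc (Suc r))" and ?y = "X (Suc r) - X (Suc (Suc r))"
    have X: "X \<in> ?J \<rightarrow>\<^sub>E ?Q" "int n dvd \<alpha>\<^sub>1 * ?x + \<beta>\<^sub>1 * ?y" "int n dvd \<alpha>\<^sub>2 * ?y"
      using that by (simp_all only: mem_iff)
    have "[\<alpha>\<^sub>1 * (?x mod int n) + \<beta>\<^sub>1 * (?y mod int n) = \<alpha>\<^sub>1 * ?x + \<beta>\<^sub>1 * ?y] (mod int n)"
      by (intro cong_add cong_mult cong_refl cong_shift)
    moreover have "[\<alpha>\<^sub>2 * (?y mod int n) = \<alpha>\<^sub>2 * ?y] (mod int n)"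
      by (intro cong_mult cong_refl cong_shift)
    ultimately have "int n dvd \<alpha>\<^sub>1 * (?x mod int n) + \<beta>\<^sub>1 * (?y mod int n)"
      "int n dvd \<alpha>\<^sub>2 * (?y mod int n)"
      using X(2,3) by (simp_all only: cong_dvd_iff)
    then show ?thesis
      using X(1) n_pos by (auto simp: PiE_iff)
  qed
  have "bij_betw ?F (?Q \<times> ?W) ?T"
  proof (rule bij_betw_byWitness[where f' = ?G])
    show "\<forall>p\<in>?Q \<times> ?W. ?G (?F p) = p"
      by (auto simp: mod_simps)
    show "\<forall>X\<in>?T. ?F (?G X) = X"
    proof
      fix X assume "X \<in> ?T"
      then have "X \<in> ?J \<rightarrow>\<^sub>E ?Q"
        by (simp only: mem_iff)
      then show "?F (?G X) = X"
        by (auto simp: fun_eq_iff PiE_iff extensional_def mod_simps)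
    qed
  qed (use F G in blast)+
  then show ?thesis
    by (simp add: bij_betw_same_card[symmetric] card_cartesian_product)
qed

end

section \<open>The standard diagrams\<close>

text \<open>\<open>C\<close> names a directed edge and a length for each face. Walks that are
  closed, disjoint and exhaustive are exactly the orbits.\<close>

lemma card_faces:
  assumes cycle: "\<And>x k. (x, k) \<in> set C \<Longrightarrow> 0 < k \<and> (turn_left D ^^ k) x = x"
    and dist: "distinct (concat (map (\<lambda>(x, k). map (\<lambda>i. (turn_left D ^^ i) x) [0..<k]) C))"
    and all: "set (concat (map (\<lambda>(x, k). map (\<lambda>i. (turn_left D ^^ i) x) [0..<k]) C)) =
      {..<length D} \<times> UNIV"
  shows "card (faces D) = length C"
proof -
  let ?f = "turn_left D"
  let ?L = "map (\<lambda>(x, k). map (\<lambda>i. (?f ^^ i) x) [0..<k]) C"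
  have orbit: "orbit ?f y = set xs" if xs: "xs \<in> set ?L" and y: "y \<in> set xs" for xs y
  proof -
    obtain x k where xk: "(x, k) \<in> set C" and "xs = map (\<lambda>i. (?f ^^ i) x) [0..<k]"
      using xs by auto
    moreover have k: "0 < k" "(?f ^^ k) x = x"
      using cycle[OF xk] by auto
    ultimately have "orbit ?f x = set xs"
      using orbit_altdef_bounded[of k ?f x] by (auto simp: image_iff)
    moreover have "x \<in> orbit ?f x"
      using k by (auto simp: orbit_altdef intro!: exI[of _ k])
    ultimately have "cyclic_on ?f (set xs)"
      by (auto simp: cyclic_on_def)
    then show ?thesis
      using y by (auto simp: cyclic_on_alldef)
  qed
  \<comment> \<open>Distinctness of a concatenation says nothing about empty lists; the positive
    lengths exclude them, so that each walk counts as one face.\<close>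
  have nonempty: "[] \<notin> set ?L"
    using cycle by fastforce
  have "faces D = set ` set ?L"
  proof -
    have "faces D = orbit ?f ` (\<Union>xs\<in>set ?L. set xs)"
      using all unfolding faces_def set_concat by simp
    also have "\<dots> = (\<Union>xs\<in>set ?L. orbit ?f ` set xs)"
      by (rule image_UN)
    also have "\<dots> = (\<Union>xs\<in>set ?L. {set xs})"
    proof (rule SUP_cong)
      fix xs assume xs: "xs \<in> set ?L"
      then have "set xs \<noteq> {}"
        using nonempty by (metis set_empty)
      then show "orbit ?f ` set xs = {set xs}"
        using orbit[OF xs] by (simp add: image_constant_conv cong: image_cong)
    qed simp
    also have "\<dots> = set ` set ?L"
      by blast
    finally show ?thesis .
  qed
  moreover have "inj_on set (set ?L)"
  proof (rule inj_onI)
    fix xs ys assume *: "xs \<in> set ?L" "ys \<in> set ?L" "set xs = set ys"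
    then have "set xs \<inter> set ys \<noteq> {}"
      using nonempty by (metis Int_absorb set_empty)
    with * show "xs = ys"
      using dist unfolding distinct_concat_iff by metis
  qed
  moreover have "distinct ?L"
    using dist nonempty unfolding distinct_concat_iff by (simp add: removeAll_id)
  ultimately show ?thesis
    using distinct_card[of ?L] by (simp add: card_image)
qed

text \<open>Each iterate is computed from its predecessor, which suits evaluation better than
  separate powers of \<open>f\<close>.\<close>

primrec trace :: "('a \<Rightarrow> 'a) \<Rightarrow> nat \<Rightarrow> 'a \<Rightarrow> 'a list" where
  "trace f 0 x = []"
| "trace f (Suc k) x = x # trace f k (f x)"

lemma trace_eq: "trace f k x = map (\<lambda>i. (f ^^ i) x) [0..<k]"
  by (induction k arbitrary: x)
    (simp_all add: upt_conv_Cons map_Suc_upt[symmetric] funpow_swap1 comp_def del: upt_Suc)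

text \<open>Each face is recorded by one of its directed edges together with its length.\<close>

definition face_cycles :: "gauss_code \<Rightarrow> ((nat \<times> bool) \<times> nat) list \<Rightarrow> bool" where
  "face_cycles D C \<longleftrightarrow>
     (\<forall>(x, k)\<in>set C. 0 < k \<and> (turn_left D ^^ k) x = x) \<and>
     (let xs = concat (map (\<lambda>(x, k). trace (turn_left D) k x) C)
      in distinct xs \<and> length xs = 2 * length D \<and> (\<forall>x\<in>set xs. fst x < length D))"

text \<open>Exhaustiveness follows by counting: there are \<open>2 * length D\<close> directed
  edges, so that many distinct ones within range are all of them.\<close>

lemma card_faces_cycles:
  assumes "face_cycles D C"
  shows "card (faces D) = length C"
proof (rule card_faces)
  let ?xs = "concat (map (\<lambda>(x, k). map (\<lambda>i. (turn_left D ^^ i) x) [0..<k]) C)"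
  have xs: "distinct ?xs" "length ?xs = 2 * length D" "\<forall>x\<in>set ?xs. fst x < length D"
    using assms unfolding face_cycles_def trace_eq Let_def by blast+
  show "distinct ?xs"
    by (rule xs)
  show "set ?xs = {..<length D} \<times> UNIV"
  proof (rule card_subset_eq)
    show "set ?xs \<subseteq> {..<length D} \<times> UNIV"
      using xs(3) by (force simp: mem_Times_iff)
    show "card (set ?xs) = card ({..<length D} \<times> (UNIV :: bool set))"
      using distinct_card[OF xs(1)] xs(2) by (simp add: card_cartesian_product)
  qed simp
  show "0 < k \<and> (turn_left D ^^ k) x = x" if "(x, k) \<in> set C" for x k
    using assms that unfolding face_cycles_def by blast
qed

text \<open>The quantifier over all labels and signs becomes one over the passages in
  \<open>D\<close>, which can be evaluated.\<close>

lemma wf_code_iff: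
  "wf_code D \<longleftrightarrow> D \<noteq> [] \<and>
     distinct (map crossing (filter is_Over D)) \<and> distinct (map crossing (filter is_Under D)) \<and>
     (\<forall>p\<in>set D. (case p of Over c s \<Rightarrow> Under c s | Under c s \<Rightarrow> Over c s) \<in> set D)"
proof -
  have "(\<forall>c s. Over c s \<in> set D \<longleftrightarrow> Under c s \<in> set D) \<longleftrightarrow>
      (\<forall>p\<in>set D. (case p of Over c s \<Rightarrow> Under c s | Under c s \<Rightarrow> Over c s) \<in> set D)"
  proof (intro iffI ballI allI)
    fix p assume "\<forall>c s. Over c s \<in> set D \<longleftrightarrow> Under c s \<in> set D" "p \<in> set D"
    then show "(case p of Over c s \<Rightarrow> Under c s | Under c s \<Rightarrow> Over c s) \<in> set D"
      by (auto split: passage.split)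
  next
    fix c s assume *: "\<forall>p\<in>set D. (case p of Over c s \<Rightarrow> Under c s | Under c s \<Rightarrow> Over c s) \<in> set D"
    show "Over c s \<in> set D \<Longrightarrow> Under c s \<in> set D" "Under c s \<in> set D \<Longrightarrow> Over c s \<in> set D"
      using bspec[OF *, of "Over c s"] bspec[OF *, of "Under c s"] by simp_all
  qed
  then show ?thesis
    by (simp add: wf_code_def)
qed

lemma wf_code_diagrams:
  "wf_code diagram_8_20" "wf_code (mirror diagram_8_20)"
  "wf_code diagram_10_140" "wf_code (mirror diagram_10_140)"
  by (rule wf_code_iff[THEN iffD2], code_simp)+

lemma face_cycles_8_20:
  "face_cycles diagram_8_20
    [((0, True), 6), ((0, False), 2), ((1, True), 2), ((1, False), 5), ((2, False), 3),
     ((3, True), 2), ((3, False), 5), ((4, False), 2), ((5, True), 3), ((6, False), 2)]"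
  by code_simp

text \<open>Reflection exchanges the two sides of every edge: the lengths recur with all direction
  flags flipped.\<close>

lemma face_cycles_mirror_8_20:
  "face_cycles (mirror diagram_8_20)
    [((0, True), 2), ((0, False), 6), ((1, True), 5), ((1, False), 2), ((2, True), 3),
     ((3, True), 5), ((3, False), 2), ((4, True), 2), ((5, False), 3), ((6, True), 2)]"
  by code_simp

lemma face_cycles_10_140:
  "face_cycles diagram_10_140
    [((0, True), 7), ((0, False), 2), ((1, True), 2), ((1, False), 7), ((2, False), 2),
     ((3, True), 3), ((4, True), 6), ((4, False), 2), ((5, True), 2), ((6, False), 3),
     ((7, True), 2), ((8, False), 2)]"
  by code_simp

lemma face_cycles_mirror_10_140:
  "face_cycles (mirror diagram_10_140)
    [((0, True), 2), ((0, False), 7), ((1, True), 7), ((1, False), 2), ((2, True), 2),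
     ((3, False), 3), ((4, True), 2), ((4, False), 6), ((5, False), 2), ((6, True), 3),
     ((7, False), 2), ((8, True), 2)]"
  by code_simp

lemma num_crossings_diagrams:
  "num_crossings diagram_8_20 = 8" "num_crossings (mirror diagram_8_20) = 8"
  "num_crossings diagram_10_140 = 10" "num_crossings (mirror diagram_10_140) = 10"
  by (simp_all add: num_crossings_def mirror_def diagram_8_20_def diagram_10_140_def)

lemma knot_diagrams:
  "knot_diagram diagram_8_20" "knot_diagram (mirror diagram_8_20)"
  "knot_diagram diagram_10_140" "knot_diagram (mirror diagram_10_140)"
  by (simp_all add: knot_diagram_def wf_code_diagrams num_crossings_diagrams
      card_faces_cycles[OF face_cycles_8_20] card_faces_cycles[OF face_cycles_mirror_8_20]
      card_faces_cycles[OF face_cycles_10_140] card_faces_cycles[OF face_cycles_mirror_10_140])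

lemma in_knot_of: "knot_diagram D \<Longrightarrow> D \<in> knot_of D"
  by (simp add: knot_of_def reidemeister_equivalent_def)

text \<open>The combinatorial content of the colouring matrix, separated so that it can be evaluated
  without touching Laurent polynomials.\<close>

definition crossing_table :: "gauss_code \<Rightarrow> (nat \<times> nat \<times> nat \<times> bool) list" where
  "crossing_table D = map (\<lambda>p. (arc_at D p, arc_at D (other D p), arc_at D (Suc p), positive (D ! p)))
     (under_positions D)"

lemma crossing_table_8_20:
  "crossing_table diagram_8_20 =
    [(0, 6, 1, True), (1, 7, 2, True), (2, 5, 3, False), (3, 6, 4, False),
     (4, 0, 5, False), (5, 3, 6, False), (6, 1, 7, True), (7, 5, 0, False)]"
  "crossing_table (mirror diagram_8_20) =
    [(0, 6, 1, False), (1, 7, 2, False), (2, 5, 3, True), (3, 6, 4, True),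
     (4, 0, 5, True), (5, 3, 6, True), (6, 1, 7, False), (7, 5, 0, True)]"
  by code_simp+

lemma crossing_table_10_140:
  "crossing_table diagram_10_140 =
    [(0, 6, 1, False), (1, 5, 2, False), (2, 9, 3, False), (3, 7, 4, True), (4, 2, 5, False),
     (5, 1, 6, False), (6, 3, 7, True), (7, 4, 8, True), (8, 2, 9, False), (9, 3, 0, False)]"
  "crossing_table (mirror diagram_10_140) =
    [(0, 6, 1, True), (1, 5, 2, True), (2, 9, 3, True), (3, 7, 4, False), (4, 2, 5, True),
     (5, 1, 6, True), (6, 3, 7, False), (7, 4, 8, False), (8, 2, 9, True), (9, 3, 0, True)]"
  by code_simp+

section \<open>The reduced colouring matrices\<close>

text \<open>Generic in \<open>t\<close> and \<open>s\<close>: the mirror image changes all signs and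
  is covered by exchanging these two arguments.\<close>

definition crossing_entry :: "'a \<Rightarrow> 'a \<Rightarrow> nat \<times> nat \<times> nat \<times> bool \<Rightarrow> nat \<Rightarrow> 'a::comm_ring_1" where
  "crossing_entry t s = (\<lambda>(i, j, l, b) k. let u = (if b then t else s) in
     (if k = i then u else 0) + (if k = j then 1 - u else 0) + (if k = l then - 1 else 0))"

lemma colouring_matrix_entry:
  assumes "r < num_crossings D" "k < num_crossings D"
  shows "colouring_matrix D $$ (r, k) = crossing_entry var var_inv (crossing_table D ! r) k"
  using assms
  by (simp add: colouring_matrix_def crossing_entry_def crossing_table_def length_under_positions Let_def)

lemma reaches_crossing_table:
  assumes "num_crossings D = N"
    and "distinct rs" "set rs = {..<N}" "distinct cs" "set cs = {..<N}"
    and "length us = N" "set us \<subseteq> {1, - 1, var, var_inv, - var, - var_inv}"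
  shows "reaches (colouring_matrix D) (mat_of_rows_list N
    (map2 (\<lambda>u r. map (\<lambda>c. u * crossing_entry var var_inv (crossing_table D ! r) c) cs) us rs))"
proof -
  have entry: "colouring_matrix D $$ (r, c) = crossing_entry var var_inv (crossing_table D ! r) c"
    if "r \<in> set rs" "c \<in> set cs" for r c
    using that unfolding assms(3,5) by (simp add: colouring_matrix_entry assms(1))
  have "map2 (\<lambda>u r. map (\<lambda>c. u * colouring_matrix D $$ (r, c)) cs) us rs =
      map2 (\<lambda>u r. map (\<lambda>c. u * crossing_entry var var_inv (crossing_table D ! r) c) cs) us rs"
  proof (rule map_cong[OF refl])
    fix p assume p: "p \<in> set (zip us rs)"
    obtain u r where ur: "p = (u, r)"
      by force
    then have "r \<in> set rs"
      using p by (simp add: set_zip_rightD)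
    then show "(case p of (u, r) \<Rightarrow> map (\<lambda>c. u * colouring_matrix D $$ (r, c)) cs) =
        (case p of (u, r) \<Rightarrow> map (\<lambda>c. u * crossing_entry var var_inv (crossing_table D ! r) c) cs)"
      by (simp add: ur entry)
  qed
  moreover have "reaches (colouring_matrix D) (mat_of_rows_list N
      (map2 (\<lambda>u r. map (\<lambda>c. u * colouring_matrix D $$ (r, c)) cs) us rs))"
    by (rule reaches_rearrange[OF _ assms(2-7)]) (simp add: colouring_matrix_def assms(1))
  ultimately show ?thesis by (simp only:)
qed

text \<open>The Alexander polynomial of the trefoil; its square is that of both knots.\<close>

definition delta :: "'a::comm_ring_1 \<Rightarrow> 'a" where
  "delta x = 1 - x + x * x"

text \<open>
  Rows and columns of the colouring matrix are arranged so that every crossing among the first rows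
  expresses one arc by arcs with later columns; for the mirror image \<open>t\<close> and \<open>s\<close> trade places.
\<close>

definition rows_8_20 :: "'a \<Rightarrow> 'a \<Rightarrow> 'a::comm_ring_1 list list" where
  "rows_8_20 t s =
    [[1, - s, 0, 0, 0, 0, 0, s - 1],
     [0, 1, - s, 0, 0, 0, s - 1, 0],
     [0, 0, 1, t - 1, - t, 0, 0, 0],
     [0, 0, 0, 1, t - 1, 0, 0, - t],
     [0, 0, 0, 0, 1, - t, 0, t - 1],
     [0, 0, 0, - (s * s), 0, s, s * s - s, 0],
     [s, 0, 0, 0, 0, 1 - s, - 1, 0],
     [0, 1 - s, 0, 0, 0, 0, s, - 1]]"

definition reduced_8_20 :: "'a \<Rightarrow> 'a \<Rightarrow> 'a::comm_ring_1 list list" where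
  "reduced_8_20 t s = (rows_8_20 t s)
    [5 := [0, 0, 0, 0, 0, 1, s * s - s, s - s * s - 1],
     6 := [0, 0, 0, 0, 0, 0, - (delta s * delta s), delta s * delta s],
     7 := [0, 0, 0, 0, 0, 0, 0, 0]]"

definition rows_10_140 :: "'a \<Rightarrow> 'a \<Rightarrow> 'a::comm_ring_1 list list" where
  "rows_10_140 t s =
    [[1, - s, 0, s - 1, 0, 0, 0, 0, 0, 0],
     [0, 1, 0, 0, 0, 0, s - 1, 0, 0, - s],
     [0, 0, 1, 0, 0, t - 1, 0, 0, - t, 0],
     [0, 0, 0, 1, 0, 0, s - 1, 0, - s, 0],
     [0, 0, 0, 0, 1, - s, 0, s - 1, 0, 0],
     [0, 0, 0, 0, 0, 1, - t, 0, t - 1, 0],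
     [0, 0, 0, 0, 0, 0, 1, - s, 0, s - 1],
     [1 - s, 0, 0, - 1, s, 0, 0, 0, 0, 0],
     [0, 0, s, 0, 0, 0, 0, 1 - s, 0, - 1],
     [s, 0, 0, 0, 1 - s, 0, 0, - 1, 0, 0]]"

definition reduced_10_140 :: "'a \<Rightarrow> 'a \<Rightarrow> 'a::comm_ring_1 list list" where
  "reduced_10_140 t s = (rows_10_140 t s)
    [7 := [0, 0, 0, 0, 0, 0, 0, s * delta s, s * (delta s - 2), - (s * delta s + s * (delta s - 2))],
     8 := [0, 0, 0, 0, 0, 0, 0, 0, t * delta s, - (t * delta s)],
     9 := [0, 0, 0, 0, 0, 0, 0, 0, 0, 0]]"

text \<open>Columns are cleared from left to right, each coefficient except the last being the
  negative of the current entry above which a unit pivot stands. Row 5 comes out with pivot 1 and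
  then serves to reduce row 6 and row 7. The last coefficient \<open>t\<close> cancels the entry
  \<open>t * delta s * delta s\<close>. That row 7 vanishes altogether reflects that one crossing
  relation of a knot diagram follows from the others.\<close>

lemma reduce_8_20:
  fixes t s :: "'a::comm_ring_1"
  assumes "t * s = 1"
  defines "R \<equiv> rows_8_20 t s"
  defines "R' \<equiv> R[5 := add_rows 5 [(s * s, 3), (s * s - s, 4)] R]"
  defines "R'' \<equiv> R'[6 := add_rows 6 [(- s, 0), (- (s * s), 1), (- (s * s * s), 2),
    (s * s - s * s * s, 3), (s * s - s * s * s - s, 4), (2 * s - s * s - 2, 5)] R']"
  shows "R''[7 := add_rows 7 [(s - 1, 1), (s * s - s, 2), (s * s + 1 - 2 * s, 3),
    (s * s + 2 - 2 * s - t, 4), (s + 2 * t - 2 - t * t, 5), (t, 6)] R''] = reduced_8_20 t s"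
proof -
  have ts: "t * s = 1" "s * t = 1" "t * (s * x) = x" "s * (t * x) = x" for x
    using assms(1) by (simp_all add: mult.commute flip: mult.assoc)
  show ?thesis
    unfolding R''_def R'_def R_def reduced_8_20_def rows_8_20_def add_rows_def delta_def
    by (simp add: algebra_simps ts)
qed

text \<open>In row 8 the entry of column 7 becomes \<open>(1 - s) - s * (t - 1)\<close>, which is 0,
  so the pivot \<open>s * delta s\<close> of row 7, in general not a unit, never has to be divided
  by. What remains in column 8 is \<open>s + t - 1 = t * delta s\<close>.\<close>

lemma reduce_10_140:
  fixes t s :: "'a::comm_ring_1"
  assumes "t * s = 1"
  defines "R \<equiv> rows_10_140 t s"
  defines "R' \<equiv> R[7 := add_rows 7 [(s - 1, 0), (s * s - s, 1), (2 * s - s * s, 3), (- s, 4),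
    (- (s * s), 5), (- (s * s), 6)] R]"
  defines "R'' \<equiv> R'[8 := add_rows 8 [(- s, 2), (1 - s, 5), (t - 1, 6)] R']"
  shows "R''[9 := add_rows 9 [(- s, 0), (- (s * s), 1), (s * s - s, 3), (s - 1, 4), (s * s - s, 5),
    (s * s - 1, 6), (1, 7), (s, 8)] R''] = reduced_10_140 t s"
proof -
  have ts: "t * s = 1" "s * t = 1" "t * (s * x) = x" "s * (t * x) = x" for x
    using assms(1) by (simp_all add: mult.commute flip: mult.assoc)
  show ?thesis
    unfolding R''_def R'_def R_def reduced_10_140_def rows_10_140_def add_rows_def delta_def
    by (simp add: algebra_simps ts)
qed

lemma reaches_add_rows_list:
  assumes "k < length R" "\<forall>r\<in>set R. length r = M"
    and "\<forall>(c, l)\<in>set ops. l < length R \<and> l \<noteq> k"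
  shows "reaches (mat_of_rows_list M R) (mat_of_rows_list M (R[k := add_rows k ops R]))"
    and "\<forall>r\<in>set (R[k := add_rows k ops R]). length r = M"
  using reaches_add_rows[of k R M ops] assms set_update_subset_insert[of R k "add_rows k ops R"]
  by fastforce+

lemma reaches_reduced_8_20:
  assumes "t * s = 1"
  shows "reaches (mat_of_rows_list 8 (rows_8_20 t s)) (mat_of_rows_list 8 (reduced_8_20 t s))"
proof -
  let ?R = "rows_8_20 t s"
  define R' where "R' = ?R[5 := add_rows 5 [(s * s, 3), (s * s - s, 4)] ?R]"
  define R'' where "R'' = R'[6 := add_rows 6 [(- s, 0), (- (s * s), 1), (- (s * s * s), 2),
    (s * s - s * s * s, 3), (s * s - s * s * s - s, 4), (2 * s - s * s - 2, 5)] R']"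
  have len: "length ?R = 8" "\<forall>r\<in>set ?R. length r = 8"
    by (simp_all add: rows_8_20_def)
  then have len': "length R' = 8" "length R'' = 8"
    by (simp_all add: R'_def R''_def)
  have R': "reaches (mat_of_rows_list 8 ?R) (mat_of_rows_list 8 R')" "\<forall>r\<in>set R'. length r = 8"
    unfolding R'_def by (rule reaches_add_rows_list; simp add: len)+
  have R'': "reaches (mat_of_rows_list 8 R') (mat_of_rows_list 8 R'')" "\<forall>r\<in>set R''. length r = 8"
    unfolding R''_def by (rule reaches_add_rows_list; simp add: len' R'(2))+
  have "reaches (mat_of_rows_list 8 R'') (mat_of_rows_list 8 (reduced_8_20 t s))"
    unfolding reduce_8_20[OF assms, folded R'_def, folded R''_def, symmetric]
    by (rule reaches_add_rows_list; simp add: len' R''(2))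
  then show ?thesis
    by (rule rtranclp_trans[OF rtranclp_trans[OF R'(1) R''(1)]])
qed

lemma reaches_reduced_10_140:
  assumes "t * s = 1"
  shows "reaches (mat_of_rows_list 10 (rows_10_140 t s)) (mat_of_rows_list 10 (reduced_10_140 t s))"
proof -
  let ?R = "rows_10_140 t s"
  define R' where "R' = ?R[7 := add_rows 7 [(s - 1, 0), (s * s - s, 1), (2 * s - s * s, 3), (- s, 4),
    (- (s * s), 5), (- (s * s), 6)] ?R]"
  define R'' where "R'' = R'[8 := add_rows 8 [(- s, 2), (1 - s, 5), (t - 1, 6)] R']"
  have len: "length ?R = 10" "\<forall>r\<in>set ?R. length r = 10"
    by (simp_all add: rows_10_140_def)
  then have len': "length R' = 10" "length R'' = 10"
    by (simp_all add: R'_def R''_def)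
  have R': "reaches (mat_of_rows_list 10 ?R) (mat_of_rows_list 10 R')" "\<forall>r\<in>set R'. length r = 10"
    unfolding R'_def by (rule reaches_add_rows_list; simp add: len)+
  have R'': "reaches (mat_of_rows_list 10 R') (mat_of_rows_list 10 R'')" "\<forall>r\<in>set R''. length r = 10"
    unfolding R''_def by (rule reaches_add_rows_list; simp add: len' R'(2))+
  have "reaches (mat_of_rows_list 10 R'') (mat_of_rows_list 10 (reduced_10_140 t s))"
    unfolding reduce_10_140[OF assms, folded R'_def, folded R''_def, symmetric]
    by (rule reaches_add_rows_list; simp add: len' R''(2))
  then show ?thesis
    by (rule rtranclp_trans[OF rtranclp_trans[OF R'(1) R''(1)]])
qed

text \<open>The first five listed crossings are solved for their outgoing arcs, whence the factors
  -1. The factor \<open>- s\<close> on the sixth is chosen so that its pivot becomes 1 after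
  elimination with rows 3 and 4.\<close>

lemma arranged_8_20:
  fixes t s :: "'a::comm_ring_1"
  shows "map2 (\<lambda>u r. map (\<lambda>c. u * crossing_entry t s (crossing_table diagram_8_20 ! r) c)
      [4, 3, 2, 7, 1, 0, 5, 6]) [- 1, - 1, - 1, - 1, - 1, - s, 1, 1] [3, 2, 1, 6, 0, 7, 4, 5] =
    rows_8_20 t s"
    and "map2 (\<lambda>u r. map (\<lambda>c. u * crossing_entry s t (crossing_table (mirror diagram_8_20) ! r) c)
      [4, 3, 2, 7, 1, 0, 5, 6]) [- 1, - 1, - 1, - 1, - 1, - s, 1, 1] [3, 2, 1, 6, 0, 7, 4, 5] =
    rows_8_20 t s"
  by (simp_all add: crossing_table_8_20 crossing_entry_def rows_8_20_def right_diff_distrib)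

text \<open>The first seven listed crossings are solved for their outgoing arcs, except crossing 6,
  which is solved for its incoming arc: the coefficient there is \<open>t\<close>, and the factor
  \<open>s\<close> turns it into 1.\<close>

lemma arranged_10_140:
  fixes t s :: "'a::comm_ring_1"
  assumes "t * s = 1"
  shows "map2 (\<lambda>u r. map (\<lambda>c. u * crossing_entry t s (crossing_table diagram_10_140 ! r) c)
      [1, 0, 8, 6, 5, 4, 3, 2, 7, 9]) [- 1, - 1, - 1, s, - 1, - 1, - 1, 1, 1, 1]
      [0, 9, 7, 6, 4, 3, 2, 5, 8, 1] = rows_10_140 t s"
    and "map2 (\<lambda>u r. map (\<lambda>c. u * crossing_entry s t (crossing_table (mirror diagram_10_140) ! r) c)
      [1, 0, 8, 6, 5, 4, 3, 2, 7, 9]) [- 1, - 1, - 1, s, - 1, - 1, - 1, 1, 1, 1]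
      [0, 9, 7, 6, 4, 3, 2, 5, 8, 1] = rows_10_140 t s"
proof -
  have "s * t = 1"
    using assms by (simp add: mult.commute)
  then show "map2 (\<lambda>u r. map (\<lambda>c. u * crossing_entry t s (crossing_table diagram_10_140 ! r) c)
      [1, 0, 8, 6, 5, 4, 3, 2, 7, 9]) [- 1, - 1, - 1, s, - 1, - 1, - 1, 1, 1, 1]
      [0, 9, 7, 6, 4, 3, 2, 5, 8, 1] = rows_10_140 t s"
    "map2 (\<lambda>u r. map (\<lambda>c. u * crossing_entry s t (crossing_table (mirror diagram_10_140) ! r) c)
      [1, 0, 8, 6, 5, 4, 3, 2, 7, 9]) [- 1, - 1, - 1, s, - 1, - 1, - 1, 1, 1, 1]
      [0, 9, 7, 6, 4, 3, 2, 5, 8, 1] = rows_10_140 t s"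
    by (simp_all add: crossing_table_10_140 crossing_entry_def rows_10_140_def right_diff_distrib)
qed

lemma reaches_8_20:
  "reaches (colouring_matrix diagram_8_20) (mat_of_rows_list 8 (reduced_8_20 var var_inv))"
  "reaches (colouring_matrix (mirror diagram_8_20)) (mat_of_rows_list 8 (reduced_8_20 var_inv var))"
proof -
  let ?rs = "[3, 2, 1, 6, 0, 7, 4, 5] :: nat list" and ?cs = "[4, 3, 2, 7, 1, 0, 5, 6] :: nat list"
  have perm: "distinct ?rs" "set ?rs = {..<8}" "distinct ?cs" "set ?cs = {..<8}"
    by (auto simp: numeral_eq_Suc lessThan_Suc)
  note arrange = reaches_crossing_table[OF _ perm]
  have "reaches (colouring_matrix diagram_8_20) (mat_of_rows_list 8 (rows_8_20 var var_inv))"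
    unfolding arranged_8_20(1)[symmetric] by (rule arrange) (auto simp: num_crossings_diagrams)
  then show "reaches (colouring_matrix diagram_8_20) (mat_of_rows_list 8 (reduced_8_20 var var_inv))"
    by (rule rtranclp_trans) (rule reaches_reduced_8_20[OF var_mult(1)])
  have "reaches (colouring_matrix (mirror diagram_8_20)) (mat_of_rows_list 8 (rows_8_20 var_inv var))"
    unfolding arranged_8_20(2)[symmetric] by (rule arrange) (auto simp: num_crossings_diagrams)
  then show "reaches (colouring_matrix (mirror diagram_8_20))
      (mat_of_rows_list 8 (reduced_8_20 var_inv var))"
    by (rule rtranclp_trans) (rule reaches_reduced_8_20[OF var_mult(2)])
qed

lemma reaches_10_140:
  "reaches (colouring_matrix diagram_10_140) (mat_of_rows_list 10 (reduced_10_140 var var_inv))"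
  "reaches (colouring_matrix (mirror diagram_10_140)) (mat_of_rows_list 10 (reduced_10_140 var_inv var))"
proof -
  let ?rs = "[0, 9, 7, 6, 4, 3, 2, 5, 8, 1] :: nat list"
    and ?cs = "[1, 0, 8, 6, 5, 4, 3, 2, 7, 9] :: nat list"
  have perm: "distinct ?rs" "set ?rs = {..<10}" "distinct ?cs" "set ?cs = {..<10}"
    by (auto simp: numeral_eq_Suc lessThan_Suc)
  note arrange = reaches_crossing_table[OF _ perm]
  have "reaches (colouring_matrix diagram_10_140) (mat_of_rows_list 10 (rows_10_140 var var_inv))"
    unfolding arranged_10_140(1)[OF var_mult(1), symmetric]
    by (rule arrange) (auto simp: num_crossings_diagrams)
  then show "reaches (colouring_matrix diagram_10_140)
      (mat_of_rows_list 10 (reduced_10_140 var var_inv))"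
    by (rule rtranclp_trans) (rule reaches_reduced_10_140[OF var_mult(1)])
  have "reaches (colouring_matrix (mirror diagram_10_140)) (mat_of_rows_list 10 (rows_10_140 var_inv var))"
    unfolding arranged_10_140(2)[OF var_mult(2), symmetric]
    by (rule arrange) (auto simp: num_crossings_diagrams)
  then show "reaches (colouring_matrix (mirror diagram_10_140))
      (mat_of_rows_list 10 (reduced_10_140 var_inv var))"
    by (rule rtranclp_trans) (rule reaches_reduced_10_140[OF var_mult(2)])
qed

lemma mat_of_rows_list_carrier [simp]:
  "length R = N \<Longrightarrow> mat_of_rows_list N R \<in> carrier_mat N N"
  by (auto simp: mat_of_rows_list_def)

lemma mat_of_rows_list_entry:
  "length R = N \<Longrightarrow> i < N \<Longrightarrow> j < N \<Longrightarrow> mat_of_rows_list N R $$ (i, j) = R ! i ! j"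
  by (auto simp: mat_of_rows_list_def)

lemma upper_triangular_rows:
  assumes "length R = N" "\<forall>i<N. \<forall>j<i. R ! i ! j = 0"
  shows "upper_triangular (mat_of_rows_list N R)"
  unfolding upper_triangular_def using assms by (auto simp: mat_of_rows_list_def)

lemma length_reduced: "length (reduced_8_20 t s) = 8" "length (reduced_10_140 t s) = 10"
  by (simp_all add: reduced_8_20_def rows_8_20_def reduced_10_140_def rows_10_140_def)

lemma upper_triangular_reduced:
  "upper_triangular (mat_of_rows_list 8 (reduced_8_20 t s))"
  "upper_triangular (mat_of_rows_list 10 (reduced_10_140 t s))"
  by (rule upper_triangular_rows, rule length_reduced,
      simp add: reduced_8_20_def rows_8_20_def reduced_10_140_def rows_10_140_def numeral_eq_Suc All_less_Suc)+

lemma diagonal_reduced: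
  "\<forall>i<6. reduced_8_20 t s ! i ! i = 1" "\<forall>i<7. reduced_10_140 t s ! i ! i = 1"
  by (simp_all add: reduced_8_20_def rows_8_20_def reduced_10_140_def rows_10_140_def
      numeral_eq_Suc All_less_Suc)

lemma last_rows_reduced_8_20:
  "reduced_8_20 t s ! 6 = [0, 0, 0, 0, 0, 0, - (delta s * delta s), delta s * delta s]"
  "reduced_8_20 t s ! 7 = [0, 0, 0, 0, 0, 0, 0, 0]"
  by (simp_all add: reduced_8_20_def rows_8_20_def)

lemma last_rows_reduced_10_140:
  "reduced_10_140 t s ! 7 = [0, 0, 0, 0, 0, 0, 0, s * delta s, s * (delta s - 2),
     - (s * delta s + s * (delta s - 2))]"
  "reduced_10_140 t s ! 8 = [0, 0, 0, 0, 0, 0, 0, 0, t * delta s, - (t * delta s)]"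
  "reduced_10_140 t s ! 9 = [0, 0, 0, 0, 0, 0, 0, 0, 0, 0]"
  by (simp_all add: reduced_10_140_def rows_10_140_def)

lemma type_I_matrix_reduced: "type_I_matrix (mat_of_rows_list 8 (reduced_8_20 t s))"
  unfolding type_I_matrix_def
  by (intro exI[of _ 8] exI[of _ "- (delta s * delta s)"] conjI)
    (use diagonal_reduced(1)[of t s] in \<open>auto simp: length_reduced upper_triangular_reduced
      mat_of_rows_list_entry last_rows_reduced_8_20\<close>)

lemma type_II_matrix_reduced: "type_II_matrix (mat_of_rows_list 10 (reduced_10_140 t s))"
  unfolding type_II_matrix_def
  by (intro exI[of _ 10] exI[of _ "s * delta s"] exI[of _ "s * (delta s - 2)"]
      exI[of _ "t * delta s"] conjI)
    (use diagonal_reduced(2)[of t s] in \<open>auto simp: length_reduced upper_triangular_reduced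
      mat_of_rows_list_entry last_rows_reduced_10_140\<close>)

section \<open>Equal counts for the four diagrams and for the knots\<close>

context invertible_mod
begin

lemma annihilator_cong:
  assumes "[a = u * b] (mod int n)" "coprime u (int n)"
  shows "annihilator a = annihilator b"
proof -
  have "int n dvd a * w \<longleftrightarrow> int n dvd b * w" for w
  proof -
    have "[a * w = u * (b * w)] (mod int n)"
      using cong_scalar_right[OF assms(1), of w] by (simp add: mult.assoc)
    then show ?thesis
      using assms(2) by (simp add: cong_dvd_iff coprime_dvd_mult_right_iff coprime_commute)
  qed
  then show ?thesis
    by (simp add: annihilator_def)
qed

lemma evaluate_delta: "[evaluate m m' (delta p) = delta (evaluate m m' p)] (mod int n)"
  unfolding delta_def evaluate_simps evaluate_one
  by (intro cong_add cong_diff cong_refl evaluate_mult)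

lemma card_solutions_8_20:
  "card (solutions (mat_of_rows_list 8 (reduced_8_20 t s))) =
     n * card (annihilator (delta (evaluate m m' s) * delta (evaluate m m' s)))"
proof -
  let ?A = "mat_of_rows_list 8 (reduced_8_20 t s)"
  let ?x = "evaluate m m' s"
  let ?a = "\<lambda>i j. evaluate m m' (?A $$ (i, j))"
  have "card (solutions ?A) = card (tail_solutions ?a 6 8)"
    using diagonal_reduced(1)[of t s]
    by (intro card_solutions_tail)
      (simp_all add: length_reduced upper_triangular_reduced mat_of_rows_list_entry)
  also have "\<dots> = n * card (annihilator (- evaluate m m' (delta s * delta s)))"
    using card_tail_solutions_type_I[of ?a 6 "- evaluate m m' (delta s * delta s)"]
    by (simp add: length_reduced mat_of_rows_list_entry last_rows_reduced_8_20 evaluate_minus)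
  also have "annihilator (- evaluate m m' (delta s * delta s)) = annihilator (delta ?x * delta ?x)"
  proof (rule annihilator_cong[where u = "- 1"])
    have "[evaluate m m' (delta s * delta s) = delta ?x * delta ?x] (mod int n)"
      by (rule cong_trans[OF evaluate_mult]) (intro cong_mult evaluate_delta)
    then show "[- evaluate m m' (delta s * delta s) = - 1 * (delta ?x * delta ?x)] (mod int n)"
      by (simp add: cong_minus_minus_iff)
  qed simp
  finally show ?thesis .
qed

text \<open>The module of the second knot is cyclic modulo every \<open>n\<close> since \<open>delta x\<close> is odd: with
  \<open>delta x = 1 + 2 h\<close> the two relations give \<open>v = - h * delta x * u\<close>.\<close>

lemma card_pairs:
  assumes "[\<alpha>\<^sub>1 = e * delta x] (mod int n)" "[\<beta>\<^sub>1 = e * (delta x - 2)] (mod int n)"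
    and "[\<alpha>\<^sub>2 = f * delta x] (mod int n)" and "coprime e (int n)" "coprime f (int n)"
  shows "card {(u, v) \<in> {0..<int n} \<times> {0..<int n}.
      int n dvd \<alpha>\<^sub>1 * u + \<beta>\<^sub>1 * v \<and> int n dvd \<alpha>\<^sub>2 * v} =
    card (annihilator (delta x * delta x))" (is "card ?W = _")
proof -
  let ?d = "delta x"
  \<comment> \<open>Here it matters that \<open>x\<close> is an integer: in the field with four
    elements, \<open>x * x - x\<close> need not be a multiple of 2.\<close>
  have "even (x * x - x)"
    by simp
  then obtain h where h: "x * x - x = 2 * h"
    by (elim dvdE)
  then have d: "?d = 1 + 2 * h"
    by (simp add: delta_def)
  have W: "?W = {(u, v) \<in> {0..<int n} \<times> {0..<int n}.
      int n dvd ?d * u + (?d - 2) * v \<and> int n dvd ?d * v}"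
  proof -
    have "int n dvd \<alpha>\<^sub>1 * u + \<beta>\<^sub>1 * v \<longleftrightarrow> int n dvd ?d * u + (?d - 2) * v" for u v
    proof -
      have "[\<alpha>\<^sub>1 * u + \<beta>\<^sub>1 * v = e * ?d * u + e * (?d - 2) * v] (mod int n)"
        by (intro cong_add cong_scalar_right assms)
      moreover have "e * ?d * u + e * (?d - 2) * v = e * (?d * u + (?d - 2) * v)"
        by (simp add: algebra_simps)
      ultimately show ?thesis
        using assms(4) by (simp add: cong_dvd_iff coprime_dvd_mult_right_iff coprime_commute)
    qed
    moreover have "int n dvd \<alpha>\<^sub>2 * v \<longleftrightarrow> int n dvd ?d * v" for v
    proof -
      have "[\<alpha>\<^sub>2 * v = f * (?d * v)] (mod int n)"
        using cong_scalar_right[OF assms(3), of v] by (simp add: mult.assoc)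
      then show ?thesis
        using assms(5) by (simp add: cong_dvd_iff coprime_dvd_mult_right_iff coprime_commute)
    qed
    ultimately show ?thesis by simp
  qed
  let ?v = "\<lambda>u. (- (h * ?d * u)) mod int n"
  have fwd: "int n dvd ?d * ?d * u \<and> v = ?v u"
    if "v \<in> {0..<int n}" "int n dvd ?d * u + (?d - 2) * v" "int n dvd ?d * v" for u v
  proof
    have "?d * ?d * u = ?d * (?d * u + (?d - 2) * v) - (?d - 2) * (?d * v)"
      by (simp add: algebra_simps)
    then show "int n dvd ?d * ?d * u"
      using that by simp
    \<comment> \<open>The coefficients come from the Bezout identity
      \<open>h * (d - 2) + (1 - h) * d = 1\<close> for \<open>d = 1 + 2 * h\<close>.\<close>
    have "v - - (h * ?d * u) = h * (?d * u + (?d - 2) * v) + (1 - h) * (?d * v)"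
      unfolding d by (simp add: algebra_simps)
    then have "int n dvd v - - (h * ?d * u)"
      using that by simp
    then have "v mod int n = ?v u"
      by (simp only: mod_eq_dvd_iff)
    then show "v = ?v u"
      using that(1) by simp
  qed
  have bwd: "int n dvd ?d * u + (?d - 2) * ?v u \<and> int n dvd ?d * ?v u"
    if u: "int n dvd ?d * ?d * u" for u
  proof
    have "[?d * u + (?d - 2) * ?v u = ?d * u + (?d - 2) * (- (h * ?d * u))] (mod int n)"
      by (intro cong_add cong_mult cong_refl cong_shift)
    \<comment> \<open>By the same identity, \<open>1 - h * (d - 2)\<close> equals
      \<open>(1 - h) * d\<close>.\<close>
    moreover have "?d * u + (?d - 2) * (- (h * ?d * u)) = (1 - h) * (?d * ?d * u)"
      unfolding d by (simp add: algebra_simps)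
    ultimately show "int n dvd ?d * u + (?d - 2) * ?v u"
      using u by (simp add: cong_dvd_iff)
    have "[?d * ?v u = ?d * (- (h * ?d * u))] (mod int n)"
      by (intro cong_mult cong_refl cong_shift)
    moreover have "int n dvd ?d * (- (h * ?d * u))"
      using dvd_mult[OF u, of "- h"] by (simp add: ac_simps)
    ultimately show "int n dvd ?d * ?v u"
      by (simp only: cong_dvd_iff)
  qed
  have "?W = (\<lambda>u. (u, ?v u)) ` annihilator (?d * ?d)"
  proof (intro Set.set_eqI iffI)
    fix p assume "p \<in> ?W"
    then obtain u v where p: "p = (u, v)" "u \<in> {0..<int n}" "v \<in> {0..<int n}"
      "int n dvd ?d * u + (?d - 2) * v" "int n dvd ?d * v"
      unfolding W by auto
    with fwd[OF p(3-5)] show "p \<in> (\<lambda>u. (u, ?v u)) ` annihilator (?d * ?d)"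
      by (auto simp: annihilator_def)
  next
    fix p assume "p \<in> (\<lambda>u. (u, ?v u)) ` annihilator (?d * ?d)"
    then obtain u where "p = (u, ?v u)" "u \<in> {0..<int n}" "int n dvd ?d * ?d * u"
      by (auto simp: annihilator_def)
    with bwd[of u] show "p \<in> ?W"
      unfolding W using n_pos by simp
  qed
  then show ?thesis
    by (simp add: card_image inj_on_def)
qed

lemma card_solutions_10_140:
  assumes "t \<in> {var, var_inv}" "s \<in> {var, var_inv}"
  shows "card (solutions (mat_of_rows_list 10 (reduced_10_140 t s))) =
     n * card (annihilator (delta (evaluate m m' s) * delta (evaluate m m' s)))"
proof -
  let ?A = "mat_of_rows_list 10 (reduced_10_140 t s)"
  let ?x = "evaluate m m' s"
  let ?a = "\<lambda>i j. evaluate m m' (?A $$ (i, j))"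
  let ?\<alpha>1 = "evaluate m m' (s * delta s)" and ?\<beta>1 = "evaluate m m' (s * (delta s - 2))"
    and ?\<alpha>2 = "evaluate m m' (t * delta s)"
  have two: "evaluate m m' 2 = 2"
    using evaluate_add[of m m' 1 1] by simp
  have "card (solutions ?A) = card (tail_solutions ?a 7 10)"
    using diagonal_reduced(2)[of t s]
    by (intro card_solutions_tail)
      (simp_all add: length_reduced upper_triangular_reduced mat_of_rows_list_entry)
  also have "\<dots> = n * card {(u, v) \<in> {0..<int n} \<times> {0..<int n}.
      int n dvd ?\<alpha>1 * u + ?\<beta>1 * v \<and> int n dvd ?\<alpha>2 * v}"
    using card_tail_solutions_type_II[of ?a 7 ?\<alpha>1 ?\<beta>1 ?\<alpha>2]
    by (simp add: length_reduced mat_of_rows_list_entry last_rows_reduced_10_140 evaluate_minus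
        evaluate_add evaluate_diff)
  also have "card {(u, v) \<in> {0..<int n} \<times> {0..<int n}.
      int n dvd ?\<alpha>1 * u + ?\<beta>1 * v \<and> int n dvd ?\<alpha>2 * v} = card (annihilator (delta ?x * delta ?x))"
  proof (rule card_pairs)
    show "[?\<alpha>1 = evaluate m m' s * delta ?x] (mod int n)"
      by (rule cong_trans[OF evaluate_mult]) (intro cong_mult cong_refl evaluate_delta)
    show "[?\<alpha>2 = evaluate m m' t * delta ?x] (mod int n)"
      by (rule cong_trans[OF evaluate_mult]) (intro cong_mult cong_refl evaluate_delta)
    show "[?\<beta>1 = evaluate m m' s * (delta ?x - 2)] (mod int n)"
      by (rule cong_trans[OF evaluate_mult], unfold evaluate_diff two)
        (intro cong_mult cong_diff cong_refl evaluate_delta)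
  qed (use assms evaluate_coprime in auto)
  finally show ?thesis .
qed

text \<open>\<open>delta\<close> is palindromic: at \<open>m'\<close> it is \<open>m' * m'\<close>
  times its value at \<open>m\<close>, and that factor is a unit modulo \<open>n\<close>. This
  brings mirror images to the same count.\<close>

lemma annihilator_inverse:
  "annihilator (delta m' * delta m') = annihilator (delta m * delta m)"
proof (rule annihilator_cong)
  have "[delta m' = (m' * m') * delta m] (mod int n)"
  proof -
    \<comment> \<open>Factors \<open>m * m'\<close> are inserted so that \<open>m' * m'\<close> can
      be taken out of every term.\<close>
    have "[(m * m') * (m * m') - m' * (m * m') + m' * m' = 1 * 1 - m' * 1 + m' * m'] (mod int n)"
      by (intro cong_add cong_diff cong_mult cong_refl inverse)
    then have "[1 * 1 - m' * 1 + m' * m' = (m * m') * (m * m') - m' * (m * m') + m' * m'] (mod int n)"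
      by (rule cong_sym)
    then show ?thesis
      by (simp add: delta_def algebra_simps)
  qed
  from cong_mult[OF this this]
  show "[delta m' * delta m' = (m' * m' * (m' * m')) * (delta m * delta m)] (mod int n)"
    by (simp add: ac_simps)
  show "coprime (m' * m' * (m' * m')) (int n)"
    using evaluate_coprime[of var_inv] by simp
qed

lemma card_colourings_diagrams:
  assumes "D \<in> {diagram_8_20, mirror diagram_8_20, diagram_10_140, mirror diagram_10_140}"
  shows "card (colourings {0..<int n} (alexander_op n m) (alexander_op n m') D) =
    n * card (annihilator (delta m * delta m))"
proof -
  have "card (solutions (colouring_matrix D)) = n * card (annihilator (delta m * delta m))"
    using assms reaches_8_20[THEN card_solutions_reaches] reaches_10_140[THEN card_solutions_reaches]
    by (auto simp: card_solutions_8_20 card_solutions_10_140 annihilator_inverse)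
  moreover have "wf_code D"
    using assms wf_code_diagrams by auto
  ultimately show ?thesis
    by (simp add: colourings_eq_solutions)
qed

lemma card_colourings_knot_of:
  assumes "D \<in> knot_of D\<^sub>0" "knot_diagram D\<^sub>0"
  shows "card (colourings {0..<int n} (alexander_op n m) (alexander_op n m') D) =
    card (colourings {0..<int n} (alexander_op n m) (alexander_op n m') D\<^sub>0)"
proof -
  interpret quandle "{0..<int n}" "\<lambda>s. alexander_op n (if s then m else m')"
    by (rule quandle_alexander)
  have "wf_code D" "wf_code D\<^sub>0"
    using assms by (auto simp: knot_of_def knot_diagram_def)
  then show ?thesis
    using card_colourings[of D] card_colourings[of D\<^sub>0] closed_knot_of[OF assms(1)] by simp
qed

end

theorem proposition17:
  assumes "K \<in> {knot_of diagram_8_20, knot_of (mirror diagram_8_20)}"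
    and "L \<in> {knot_of diagram_10_140, knot_of (mirror diagram_10_140)}"
  shows "type_I K \<and> type_II L \<and>
    (\<forall>(n::nat) (m::int). n > 0 \<and> coprime m (int n) \<longrightarrow>
       (\<forall>D \<in> K. \<forall>E \<in> L. num_alexander_colourings n m D = num_alexander_colourings n m E))"
proof (intro conjI allI impI ballI)
  obtain D\<^sub>0 where D\<^sub>0: "D\<^sub>0 \<in> {diagram_8_20, mirror diagram_8_20}" "K = knot_of D\<^sub>0"
    using assms(1) by blast
  obtain E\<^sub>0 where E\<^sub>0: "E\<^sub>0 \<in> {diagram_10_140, mirror diagram_10_140}" "L = knot_of E\<^sub>0"
    using assms(2) by blast
  have diagrams: "knot_diagram D\<^sub>0" "knot_diagram E\<^sub>0"
    using D\<^sub>0(1) E\<^sub>0(1) knot_diagrams by auto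
  show "type_I K"
    unfolding type_I_def equivalent_to_def
    using D\<^sub>0 in_knot_of[OF diagrams(1)] reaches_8_20 type_I_matrix_reduced by blast
  show "type_II L"
    unfolding type_II_def equivalent_to_def
    using E\<^sub>0 in_knot_of[OF diagrams(2)] reaches_10_140 type_II_matrix_reduced by blast
  fix n :: nat and m :: int and D E
  assume nm: "n > 0 \<and> coprime m (int n)" and "D \<in> K" "E \<in> L"
  interpret invertible_mod n m "modular_inverse (int n) m"
    by unfold_locales (use nm cong_modular_inverse1 in auto)
  show "num_alexander_colourings n m D = num_alexander_colourings n m E"
    unfolding num_alexander_colourings_def
    using \<open>D \<in> K\<close> \<open>E \<in> L\<close> D\<^sub>0 E\<^sub>0 diagrams card_colourings_knot_of card_colourings_diagrams
    by (metis insertCI insertE)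
qed

end
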